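(* Let $\Bbbk$ be an algebraically closed field and let $\mathcal P$ be a finitely generated prime operad over $\Bbbk$. If $\operatorname{GKdim}(\mathcal P)=1$, then $\mathcal P$ is a suboperad of $\mathcal{C}om_{\Bbbk}$ or of $\mathcal{O}pe_{\Bbbk}$.
   Context: "Operad" means a symmetric operad $\mathcal P$ in $\Bbbk$-vector spaces, given by right $\Bbbk\mathbb S_n$-modules $\mathcal P(n)$ ($n\ge 0$), an identity $1_{\mathcal P}\in\mathcal P(1)$ and partial compositions $\circ_i:\mathcal P(m)\otimes\mathcal P(n)\to\mathcal P(m+n-1)$, $1\le i\le m$, satisfying the usual unit, associativity and equivariance axioms. All operads are reduced ($\mathcal P(0)=0$) and locally finite ($\dim_\Bbbk\mathcal P(n)<\infty$). $\mathcal P$ is finitely generated if it is generated by finitely many elements as a symmetric operad. $\operatorname{GKdim}(\mathcal P)=\limsup_{n\to\infty}\log_n\bigl(\sum_{i=0}^n\dim\mathcal P(i)\bigr)$. For subcollections $I,J$ of $\mathcal P$, $I\circ J$ is the $\mathbb S$-submodule generated by all $x\circ_i y$ with $x\in I$, $y\in J$, $1\le i\le$ arity of $x$. $\mathcal P$ is prime if $I\circ J\ne 0$ for all nonzero (two-sided) ideals $I,J$ of $\mathcal P$. $\mathcal{C}om_\Bbbk$ is the operad of nonunital commutative algebras: $\mathcal{C}om_\Bbbk(n)=\Bbbk\mu_n$ for $n\ge 1$, with trivial $\mathbb S_n$-action and $\mu_n\circ_i\mu_m=\mu_{n+m-1}$. $\mathcal{O}pe_\Bbbk$ is the operad with $\mathcal{O}pe_\Bbbk(n)=0$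 for $n$ even, $\mathcal{O}pe_\Bbbk(n)=\Bbbk\mu_n$ for $n$ odd, $\mu_n*\sigma=\operatorname{sgn}(\sigma)\mu_n$ for $\sigma\in\mathbb S_n$, and $\mu_n\circ_i\mu_m=\mu_{n+m-1}$ for $n,m$ odd and $1\le i\le n$. "Is a suboperad of" is understood up to isomorphism of operads. *)

theory Defs
  imports
    Complex_Main
    "HOL-Library.Extended_Real"
    "HOL-Computational_Algebra.Polynomial"
    "HOL-Combinatorics.Permutations"
begin

text \<open>
  The components of an operad are subspaces \<open>op_space P n\<close> of one ambient vector space (for
  instance of their direct sum); they need not be independent of each other, since all operations
  carry the arities of their arguments.  Arities and input positions follow the usual convention:
  the inputs of an operation of arity \<open>n\<close> are numbered by \<open>{1..n}\<close>, and the symmetric group of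
  degree \<open>n\<close> consists of the functions \<open>\<sigma>\<close> with \<open>\<sigma> permutes {1..n}\<close>.  Further,
  \<^item> \<open>op_act P n x \<sigma>\<close> is the right action of \<open>\<sigma>\<close> on \<open>x\<close> of arity \<open>n\<close>;
  \<^item> \<open>op_comp P m n i x y\<close> is the partial composition of \<open>x\<close> of arity \<open>m\<close> with \<open>y\<close> of arity \<open>n\<close>
    at the \<open>i\<close>-th input of \<open>x\<close>, and has arity \<open>m + n - 1\<close>.
\<close>

record ('k, 'v) operad_data =
  op_scale :: "'k \<Rightarrow> 'v \<Rightarrow> 'v"
  op_space :: "nat \<Rightarrow> 'v set"
  op_act :: "nat \<Rightarrow> 'v \<Rightarrow> (nat \<Rightarrow> nat) \<Rightarrow> 'v"
  op_unit :: 'v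
  op_comp :: "nat \<Rightarrow> nat \<Rightarrow> nat \<Rightarrow> 'v \<Rightarrow> 'v \<Rightarrow> 'v"

text \<open>
  The permutation \<open>\<sigma> \<circ>\<^sub>i \<tau>\<close> of \<open>{1..m + n - 1}\<close> for permutations \<open>\<sigma>\<close> of \<open>{1..m}\<close> and \<open>\<tau>\<close> of
  \<open>{1..n}\<close>.  For the right action, input \<open>j\<close> of \<open>x * \<sigma>\<close> is fed into slot \<open>\<sigma> j\<close> of \<open>x\<close>; accordingly
  \<open>\<sigma> \<circ>\<^sub>i \<tau>\<close> sends the block \<open>{i..i + n - 1}\<close> onto the block starting at \<open>\<sigma> i\<close>, permuted
  by \<open>\<tau>\<close>, and moves the remaining inputs as \<open>\<sigma>\<close> does.
\<close>

definition perm_pcomp ::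
    "nat \<Rightarrow> nat \<Rightarrow> nat \<Rightarrow> (nat \<Rightarrow> nat) \<Rightarrow> (nat \<Rightarrow> nat) \<Rightarrow> nat \<Rightarrow> nat" where
  "perm_pcomp m n i \<sigma> \<tau> j =
    (if j \<notin> {1..m + n - 1} then j
     else if i \<le> j \<and> j < i + n then \<sigma> i + \<tau> (j + 1 - i) - 1
     else let s = \<sigma> (if j < i then j else j + 1 - n)
          in if s < \<sigma> i then s else s + n - 1)"

locale operad = vector_space "op_scale P"
  for P :: "('k::field, 'v::ab_group_add) operad_data" +
  assumes space_subspace: "module.subspace (op_scale P) (op_space P n)"
    and act_closed: "x \<in> op_space P n \<Longrightarrow> \<sigma> permutes {1..n} \<Longrightarrow> op_act P n x \<sigma> \<in> op_space P n"
    and act_add: "x \<in> op_space P n \<Longrightarrow> y \<in> op_space P n \<Longrightarrow> \<sigma> permutes {1..n} \<Longrightarrow>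
      op_act P n (x + y) \<sigma> = op_act P n x \<sigma> + op_act P n y \<sigma>"
    and act_scale: "x \<in> op_space P n \<Longrightarrow> \<sigma> permutes {1..n} \<Longrightarrow>
      op_act P n (op_scale P c x) \<sigma> = op_scale P c (op_act P n x \<sigma>)"
    and act_id: "x \<in> op_space P n \<Longrightarrow> op_act P n x id = x"
    and act_act: "x \<in> op_space P n \<Longrightarrow> \<sigma> permutes {1..n} \<Longrightarrow> \<tau> permutes {1..n} \<Longrightarrow>
      op_act P n (op_act P n x \<sigma>) \<tau> = op_act P n x (\<sigma> \<circ> \<tau>)"
    and unit_closed: "op_unit P \<in> op_space P 1"
    and comp_closed: "x \<in> op_space P m \<Longrightarrow> y \<in> op_space P n \<Longrightarrow> i \<in> {1..m} \<Longrightarrow>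
      op_comp P m n i x y \<in> op_space P (m + n - 1)"
    and comp_add_left: "x \<in> op_space P m \<Longrightarrow> x' \<in> op_space P m \<Longrightarrow> y \<in> op_space P n \<Longrightarrow>
      i \<in> {1..m} \<Longrightarrow>
      op_comp P m n i (x + x') y = op_comp P m n i x y + op_comp P m n i x' y"
    and comp_scale_left: "x \<in> op_space P m \<Longrightarrow> y \<in> op_space P n \<Longrightarrow> i \<in> {1..m} \<Longrightarrow>
      op_comp P m n i (op_scale P c x) y = op_scale P c (op_comp P m n i x y)"
    and comp_add_right: "x \<in> op_space P m \<Longrightarrow> y \<in> op_space P n \<Longrightarrow> y' \<in> op_space P n \<Longrightarrow>
      i \<in> {1..m} \<Longrightarrow>
      op_comp P m n i x (y + y') = op_comp P m n i x y + op_comp P m n i x y'"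
    and comp_scale_right: "x \<in> op_space P m \<Longrightarrow> y \<in> op_space P n \<Longrightarrow> i \<in> {1..m} \<Longrightarrow>
      op_comp P m n i x (op_scale P c y) = op_scale P c (op_comp P m n i x y)"
    and unit_comp: "x \<in> op_space P n \<Longrightarrow> op_comp P 1 n 1 (op_unit P) x = x"
    and comp_unit: "x \<in> op_space P m \<Longrightarrow> i \<in> {1..m} \<Longrightarrow> op_comp P m 1 i x (op_unit P) = x"
    and comp_assoc_sequential:
      "x \<in> op_space P m \<Longrightarrow> y \<in> op_space P n \<Longrightarrow> z \<in> op_space P l \<Longrightarrow>
       i \<in> {1..m} \<Longrightarrow> j \<in> {1..n} \<Longrightarrow>
       op_comp P (m + n - 1) l (i - 1 + j) (op_comp P m n i x y) z =
       op_comp P m (n + l - 1) i x (op_comp P n l j y z)"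
    and comp_assoc_parallel:
      "x \<in> op_space P m \<Longrightarrow> y \<in> op_space P n \<Longrightarrow> z \<in> op_space P l \<Longrightarrow>
       i \<in> {1..m} \<Longrightarrow> k \<in> {1..m} \<Longrightarrow> i < k \<Longrightarrow>
       op_comp P (m + n - 1) l (k - 1 + n) (op_comp P m n i x y) z =
       op_comp P (m + l - 1) n i (op_comp P m l k x z) y"
    and comp_equivariant:
      "x \<in> op_space P m \<Longrightarrow> y \<in> op_space P n \<Longrightarrow> i \<in> {1..m} \<Longrightarrow>
       \<sigma> permutes {1..m} \<Longrightarrow> \<tau> permutes {1..n} \<Longrightarrow>
       op_comp P m n i (op_act P m x \<sigma>) (op_act P n y \<tau>) =
       op_act P (m + n - 1) (op_comp P m n (\<sigma> i) x y) (perm_pcomp m n i \<sigma> \<tau>)"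

definition reduced :: "('k::field, 'v::ab_group_add) operad_data \<Rightarrow> bool" where
  "reduced P \<longleftrightarrow> op_space P 0 = {0}"

definition locally_finite :: "('k::field, 'v::ab_group_add) operad_data \<Rightarrow> bool" where
  "locally_finite P \<longleftrightarrow>
    (\<forall>n. \<exists>B. finite B \<and> B \<subseteq> op_space P n \<and> module.span (op_scale P) B = op_space P n)"

text \<open>
  A subcollection is given by its components \<open>S :: nat \<Rightarrow> 'v set\<close>; inclusion of subcollections is
  the pointwise order \<open>\<le>\<close>, and \<open>Inf\<close> below is the componentwise intersection.
\<close>

definition S_submodule ::
    "('k::field, 'v::ab_group_add) operad_data \<Rightarrow> (nat \<Rightarrow> 'v set) \<Rightarrow> bool" where
  "S_submodule P S \<longleftrightarrow> S \<le> op_space P \<and>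
    (\<forall>n. module.subspace (op_scale P) (S n)) \<and>
    (\<forall>n x \<sigma>. x \<in> S n \<longrightarrow> \<sigma> permutes {1..n} \<longrightarrow> op_act P n x \<sigma> \<in> S n)"

definition S_submodule_generated ::
    "('k::field, 'v::ab_group_add) operad_data \<Rightarrow> (nat \<Rightarrow> 'v set) \<Rightarrow> nat \<Rightarrow> 'v set" where
  "S_submodule_generated P X = Inf {S. S_submodule P S \<and> X \<le> S}"

definition suboperad ::
    "('k::field, 'v::ab_group_add) operad_data \<Rightarrow> (nat \<Rightarrow> 'v set) \<Rightarrow> bool" where
  "suboperad P S \<longleftrightarrow> S_submodule P S \<and> op_unit P \<in> S 1 \<and>
    (\<forall>m n i x y. x \<in> S m \<longrightarrow> y \<in> S n \<longrightarrow> i \<in> {1..m} \<longrightarrow> op_comp P m n i x y \<in> S (m + n - 1))"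

definition suboperad_generated ::
    "('k::field, 'v::ab_group_add) operad_data \<Rightarrow> (nat \<Rightarrow> 'v set) \<Rightarrow> nat \<Rightarrow> 'v set" where
  "suboperad_generated P X = Inf {S. suboperad P S \<and> X \<le> S}"

definition finitely_generated :: "('k::field, 'v::ab_group_add) operad_data \<Rightarrow> bool" where
  "finitely_generated P \<longleftrightarrow>
    (\<exists>X. X \<le> op_space P \<and> finite (SIGMA n:UNIV. X n) \<and> suboperad_generated P X = op_space P)"

definition operad_ideal ::
    "('k::field, 'v::ab_group_add) operad_data \<Rightarrow> (nat \<Rightarrow> 'v set) \<Rightarrow> bool" where
  "operad_ideal P I \<longleftrightarrow> S_submodule P I \<and>
    (\<forall>m n i x y. x \<in> op_space P m \<longrightarrow> y \<in> op_space P n \<longrightarrow> i \<in> {1..m} \<longrightarrow>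
       x \<in> I m \<or> y \<in> I n \<longrightarrow> op_comp P m n i x y \<in> I (m + n - 1))"

definition subcollection_comp ::
    "('k::field, 'v::ab_group_add) operad_data \<Rightarrow>
     (nat \<Rightarrow> 'v set) \<Rightarrow> (nat \<Rightarrow> 'v set) \<Rightarrow> nat \<Rightarrow> 'v set" where
  "subcollection_comp P I J = S_submodule_generated P
    (\<lambda>k. {op_comp P m n i x y | m n i x y.
           k = m + n - 1 \<and> x \<in> I m \<and> y \<in> J n \<and> i \<in> {1..m}})"

definition prime_operad :: "('k::field, 'v::ab_group_add) operad_data \<Rightarrow> bool" where
  "prime_operad P \<longleftrightarrow>
    (\<forall>I J. operad_ideal P I \<longrightarrow> operad_ideal P J \<longrightarrow> I \<noteq> (\<lambda>_. {0}) \<longrightarrow> J \<noteq> (\<lambda>_. {0}) \<longrightarrow>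
       subcollection_comp P I J \<noteq> (\<lambda>_. {0}))"

text \<open>
  Only meaningful for locally finite operads, as \<open>dim\<close> is \<open>0\<close> on infinite-dimensional spaces.
  For the zero operad the value is \<open>0\<close>, because \<open>log b 0 = 0\<close>.
\<close>

definition GKdim :: "('k::field, 'v::ab_group_add) operad_data \<Rightarrow> ereal" where
  "GKdim P = limsup (\<lambda>n. ereal (log (real n)
     (real (\<Sum>i\<le>n. vector_space.dim (op_scale P) (op_space P i)))))"

definition operad_hom ::
    "('k::field, 'v::ab_group_add) operad_data \<Rightarrow> ('k, 'w::ab_group_add) operad_data \<Rightarrow>
     (nat \<Rightarrow> 'v \<Rightarrow> 'w) \<Rightarrow> bool" where
  "operad_hom P Q f \<longleftrightarrow>
    (\<forall>n. \<forall>x \<in> op_space P n. f n x \<in> op_space Q n) \<and>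
    (\<forall>n. \<forall>x \<in> op_space P n. \<forall>y \<in> op_space P n. f n (x + y) = f n x + f n y) \<and>
    (\<forall>n c. \<forall>x \<in> op_space P n. f n (op_scale P c x) = op_scale Q c (f n x)) \<and>
    (\<forall>n \<sigma>. \<forall>x \<in> op_space P n. \<sigma> permutes {1..n} \<longrightarrow>
       f n (op_act P n x \<sigma>) = op_act Q n (f n x) \<sigma>) \<and>
    f 1 (op_unit P) = op_unit Q \<and>
    (\<forall>m n. \<forall>i \<in> {1..m}. \<forall>x \<in> op_space P m. \<forall>y \<in> op_space P n.
       f (m + n - 1) (op_comp P m n i x y) = op_comp Q m n i (f m x) (f n y))"

definition operad_isomorphic ::
    "('k::field, 'v::ab_group_add) operad_data \<Rightarrow> ('k, 'w::ab_group_add) operad_data \<Rightarrow> bool" where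
  "operad_isomorphic P Q \<longleftrightarrow>
    (\<exists>f. operad_hom P Q f \<and> (\<forall>n. bij_betw (f n) (op_space P n) (op_space Q n)))"

definition is_suboperad_of ::
    "('k::field, 'v::ab_group_add) operad_data \<Rightarrow> ('k, 'w::ab_group_add) operad_data \<Rightarrow> bool" where
  "is_suboperad_of P Q \<longleftrightarrow>
    (\<exists>S. suboperad Q S \<and> operad_isomorphic P (Q\<lparr>op_space := S\<rparr>))"

text \<open>
  In the following two operads the ambient vector space is the field itself, and the basis
  element \<open>\<mu>\<^sub>n\<close> of a one-dimensional component is represented by \<open>1\<close>.
\<close>

definition Com :: "('k::field, 'k) operad_data" where
  "Com = \<lparr>op_scale = (*),
          op_space = (\<lambda>n. if n \<ge> 1 then UNIV else {0}),
          op_act = (\<lambda>n x \<sigma>. x),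
          op_unit = 1,
          op_comp = (\<lambda>m n i x y. x * y)\<rparr>"

definition Ope :: "('k::field, 'k) operad_data" where
  "Ope = \<lparr>op_scale = (*),
          op_space = (\<lambda>n. if odd n then UNIV else {0}),
          op_act = (\<lambda>n x \<sigma>. of_int (sign \<sigma>) * x),
          op_unit = 1,
          op_comp = (\<lambda>m n i x y. x * y)\<rparr>"

end

theory Submission
  imports Defs "HOL-Real_Asymp.Real_Asymp"
begin

text \<open>
  Write \<open>x \<circ>\<^sub>i y\<close> for partial composition and \<open>v * \<sigma>\<close> for the action.  The idea is to show that every
  permutation acts on \<open>P\<close> through a character of order at most two.  Composition then hardly depends on
  the input, and \<open>P\<close> becomes a graded commutative algebra without zero divisors whose components are
  at most lines; such an algebra sits inside a polynomial ring in one variable, and the powers of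
  the variable are the \<open>\<mu>\<^sub>n\<close>.

  Primeness is used mostly in one form: the right annihilator of a nonzero ideal is an ideal, so it
  is zero (\<open>prime_annihilated_imp_zero\<close>).  Since \<open>P\<close> has elements of arbitrarily large arity and those
  form an ideal, a nonzero element \<open>z\<close> satisfies \<open>y \<circ>\<^sub>i z \<noteq> 0\<close> for some \<open>y\<close> of large arity
  (\<open>large_arity_faithful\<close>).  Finite generation improves this: a tree of generators carrying \<open>z\<close> at a
  leaf can be cut down one vertex at a time without detaching \<open>z\<close>, so suitable arities of \<open>y\<close> occur
  with bounded gaps (\<open>annihilated_window_imp_annihilated\<close>).

  Suppose two transpositions with a common point act differently on some \<open>v\<close>, so that
  \<open>z = v * (a b) - v * (a c) \<noteq> 0\<close>.  Every \<open>y \<circ>\<^sub>i z\<close> is again such a difference.  In an arity \<open>N\<close> in which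
  a nonzero difference of this kind exists, the \<open>N - 2\<close> operators \<open>(a j)\<close> with \<open>j \<noteq> a, c\<close> are linearly
  independent, so the dimension is at least \<open>sqrt (N - 2)\<close>.  As these arities have bounded gaps, the
  sum of the dimensions grows at least like \<open>n powr (3/2)\<close>, against Gelfand-Kirillov dimension 1.  Hence all
  transpositions act by one involution \<open>s\<close>.

  The images of \<open>s - 1\<close> and \<open>s + 1\<close> in arities at least 3 are ideals whose product is zero because
  \<open>s\<^sup>2 = 1\<close>; by primeness \<open>s\<close> is a scalar \<open>\<kappa> = \<plusminus>1\<close>.  Equivariance now gives
  \<open>x \<circ>\<^sub>i y = \<plusminus>(x \<circ>\<^sub>1 y)\<close>, the parallel axiom gives supercommutativity of \<open>\<circ>\<^sub>1\<close>, and primeness excludes zero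
  divisors.  If \<open>\<kappa> = -1 \<noteq> 1\<close>, an element of even arity has square zero and therefore vanishes, so \<open>\<circ>\<^sub>1\<close> is
  commutative in all cases.

  Two linearly independent elements of the same arity would make all monomials
  \<open>x\<^sup>i y\<^sup>k\<^sup>-\<^sup>i\<close> independent, because a binary form over an algebraically closed field is a product of
  linear factors; again the dimensions would be too large.  Finally, a graded commutative domain with
  components of dimension at most one embeds into scalars: if the degrees have greatest common divisor
  \<open>g\<close> and \<open>u, v\<close> are homogeneous with degrees differing by \<open>g\<close>, then \<open>x\<close> of degree \<open>gq\<close> is sent to the
  scalar \<open>x v\<^sup>q / u\<^sup>q\<close>.
\<close>

section \<open>Growth functions\<close>

lemma growth_one_imp_unbounded_support:
  fixes D :: "nat \<Rightarrow> nat"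
  assumes "limsup (\<lambda>n. ereal (log (real n) (real (\<Sum>i\<le>n. D i)))) = 1"
  shows "\<exists>n\<ge>a. D n \<noteq> 0"
proof (rule ccontr)
  assume "\<not> ?thesis"
  then have zero: "D n = 0" if "n \<ge> a" for n using that by blast
  define C where "C = (\<Sum>i\<le>a. D i)"
  have F: "(\<Sum>i\<le>n. D i) = C" if "n \<ge> a" for n
    unfolding C_def using that zero by (intro sum.mono_neutral_right) auto
  have "eventually (\<lambda>n. log (real n) (1 + real C) < 1/2) at_top"
  proof -
    have "0 < 1 + real C" by simp
    then show ?thesis by real_asymp
  qed
  then have "eventually (\<lambda>n. ereal (log (real n) (real (\<Sum>i\<le>n. D i))) \<le> ereal (1/2)) sequentially"
    using eventually_ge_at_top[of a] eventually_ge_at_top[of 2]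
  proof eventually_elim
    case (elim n)
    have "log (real n) (real C) \<le> 1/2"
    proof (cases "C = 0")
      case False
      then have "log (real n) (real C) \<le> log (real n) (1 + real C)"
        using elim by (subst log_le_cancel_iff) auto
      then show ?thesis using elim by linarith
    qed (simp add: log_def)
    then show ?case using F[OF elim(2)] by simp
  qed
  then have "limsup (\<lambda>n. ereal (log (real n) (real (\<Sum>i\<le>n. D i)))) \<le> ereal (1/2)"
    by (rule Limsup_bounded)
  then show False using assms by simp
qed

text \<open>
  Dimensions of order \<open>sqrt n\<close> along a sequence of arities with bounded gaps already force growth of
  order \<open>n powr (3/2)\<close>.  The square is convenient because the lower bounds needed below come from
  independent operators on a component, whose number is at most the square of its dimension.
\<close>

lemma growth_one_imp_small_window:
  fixes D :: "nat \<Rightarrow> nat"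
  assumes lim: "limsup (\<lambda>n. ereal (log (real n) (real (\<Sum>i\<le>n. D i)))) = 1"
    and d: "d > 0"
  shows "\<exists>a\<ge>1. \<forall>n\<in>{a..<a+d}. n > K * (D n)\<^sup>2"
proof (rule ccontr)
  assume "\<not> ?thesis"
  then have window: "\<exists>n\<in>{a..<a+d}. n \<le> K * (D n)\<^sup>2" if "a \<ge> 1" for a
    using that not_less by blast
  have "\<forall>j. \<exists>n. n \<in> {1 + j*d..<1 + j*d + d} \<and> n \<le> K * (D n)\<^sup>2"
    using window[OF le_add1] by blast
  then obtain n where n: "\<And>j. n j \<in> {1 + j*d..<1 + j*d + d}" "\<And>j. n j \<le> K * (D (n j))\<^sup>2"
    by metis
  have K: "K > 0" using n(1)[of 0] n(2)[of 0] by (cases "K = 0") auto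
  have n_less: "n j < n k" if "j < k" for j k
  proof -
    have "j*d + d \<le> k*d" using that by (metis Suc_leI mult.commute mult_Suc_right mult_le_mono1 add.commute)
    then show ?thesis using n(1)[of j] n(1)[of k] by auto
  qed
  have inj: "inj_on n A" for A using n_less by (metis inj_onI linorder_neqE_nat less_irrefl)
  have lower: "real M * sqrt (real M / real K) \<le> real (\<Sum>i\<le>2*M*d. D i)" for M
  proof -
    have each: "sqrt (real M / real K) \<le> real (D (n j))" if "j \<in> {M..<2*M}" for j
    proof -
      have "M \<le> j * d" using that d by (metis atLeastLessThan_iff le_trans mult.right_neutral mult_le_mono2 Suc_leI One_nat_def)
      then have "M \<le> K * (D (n j))\<^sup>2" using n[of j] by auto
      then have "real M \<le> real K * (real (D (n j)))\<^sup>2" by (metis of_nat_mono of_nat_mult of_nat_power)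
      then have "real M / real K \<le> (real (D (n j)))\<^sup>2" using K by (simp add: field_simps)
      then show ?thesis by (simp add: real_le_lsqrt)
    qed
    have sub: "n ` {M..<2*M} \<subseteq> {..2*M*d}"
    proof
      fix x assume "x \<in> n ` {M..<2*M}"
      then obtain j where j: "j < 2*M" "x = n j" by auto
      then have "j*d + d \<le> 2*M*d" by (metis Suc_leI mult.commute mult_Suc_right mult_le_mono1 add.commute)
      then show "x \<in> {..2*M*d}" using j n(1)[of j] by auto
    qed
    have "real M * sqrt (real M / real K) = (\<Sum>j\<in>{M..<2*M}. sqrt (real M / real K))" by simp
    also have "\<dots> \<le> (\<Sum>j\<in>{M..<2*M}. real (D (n j)))" by (rule sum_mono) (rule each)
    also have "\<dots> = real (\<Sum>i\<in>n ` {M..<2*M}. D i)"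
      by (subst sum.reindex[OF inj]) simp
    also have "\<dots> \<le> real (\<Sum>i\<le>2*M*d. D i)"
      using sub by (intro of_nat_mono sum_mono2) auto
    finally show ?thesis .
  qed
  have "eventually (\<lambda>n. ereal (log (real n) (real (\<Sum>i\<le>n. D i))) < ereal (5/4)) sequentially"
    by (rule Limsup_lessD) (simp add: lim one_ereal_def del: of_nat_sum)
  then obtain N where N: "\<And>n. n \<ge> N \<Longrightarrow> log (real n) (real (\<Sum>i\<le>n. D i)) < 5/4"
    unfolding eventually_sequentially by auto
  have "real d > 0" "real K > 0" using d K by auto
  then have "eventually (\<lambda>M. (2 * real M * real d) powr (5/4) < real M * sqrt (real M / real K)) at_top"
    by real_asymp
  then obtain M0 where M0: "\<And>M. M \<ge> M0 \<Longrightarrow> (2 * real M * real d) powr (5/4) < real M * sqrt (real M / real K)"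
    unfolding eventually_sequentially by auto
  \<comment> \<open>The windows with indices in \<open>{M..<2 * M}\<close> contribute more than \<open>(2 * M * d) powr (5/4)\<close> to the sum.
    Any exponent strictly between 1 and 3/2 in place of 5/4 would do.\<close>
  define M where "M = max M0 (max N 1)"
  define m where "m = 2*M*d"
  have "M \<le> M * d" using d by simp
  then have m: "m \<ge> N" "m \<ge> 2" "M \<ge> M0" "M \<ge> 1" unfolding M_def m_def by auto
  have "0 < real M * sqrt (real M / real K)" using m K by simp
  then have pos: "0 < real (\<Sum>i\<le>m. D i)" using lower[of M] unfolding m_def by linarith
  have "real (\<Sum>i\<le>m. D i) < real m powr (5/4)"
    using N[OF m(1)] pos m(2) by (subst (asm) log_less_iff) auto
  also have "real m = 2 * real M * real d" by (simp add: m_def)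
  also have "\<dots> powr (5/4) < real M * sqrt (real M / real K)" by (rule M0[OF m(3)])
  also have "\<dots> \<le> real (\<Sum>i\<le>m. D i)" using lower[of M] by (simp add: m_def)
  finally show False by simp
qed

section \<open>Linear algebra\<close>

lemma homogeneous_system_nontrivial_solution:
  fixes f :: "'e \<Rightarrow> 'j \<Rightarrow> 'k::field"
  assumes "finite E" "finite J" "card E < card J"
  shows "\<exists>a. (\<exists>j\<in>J. a j \<noteq> 0) \<and> (\<forall>e\<in>E. (\<Sum>j\<in>J. a j * f e j) = 0)"
  using assms
proof (induction E arbitrary: J f rule: finite_induct)
  case empty
  then have "J \<noteq> {}" by auto
  then show ?case by (intro exI[of _ "\<lambda>_. 1"]) auto
next
  case (insert e E)
  show ?case
  proof (cases "\<forall>j\<in>J. f e j = 0")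
    case True
    from insert have "card E < card J" by simp
    from insert.IH[OF insert.prems(1) this, of f] show ?thesis using True by auto
  next
    case False
    then obtain j0 where j0: "j0 \<in> J" "f e j0 \<noteq> 0" by blast
    define J' where "J' = J - {j0}"
    have J': "finite J'" "card E < card J'" "J = insert j0 J'" "j0 \<notin> J'"
      using insert j0 by (auto simp: J'_def)
    from insert.IH[OF J'(1,2), of "\<lambda>e' j. f e' j - f e' j0 * f e j / f e j0"]
    obtain a where a: "\<exists>j\<in>J'. a j \<noteq> 0"
      "\<And>e'. e' \<in> E \<Longrightarrow> (\<Sum>j\<in>J'. a j * (f e' j - f e' j0 * f e j / f e j0)) = 0" by blast
    \<comment> \<open>Gaussian elimination: \<open>s\<close> is the value of the unknown \<open>j0\<close> dictated by equation \<open>e\<close>.\<close>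
    define s where "s = - (\<Sum>j\<in>J'. a j * f e j) / f e j0"
    define b where "b = a(j0 := s)"
    have sum_b: "(\<Sum>j\<in>J. b j * f e' j) = s * f e' j0 + (\<Sum>j\<in>J'. a j * f e' j)" for e'
    proof -
      have "(\<Sum>j\<in>J'. b j * f e' j) = (\<Sum>j\<in>J'. a j * f e' j)"
        using J'(4) by (intro sum.cong) (auto simp: b_def)
      then show ?thesis using J' by (simp add: b_def)
    qed
    have "(\<Sum>j\<in>J. b j * f e' j) = 0" if e': "e' \<in> insert e E" for e'
    proof (cases "e' = e")
      case True
      then show ?thesis using j0 by (simp add: sum_b s_def)
    next
      case False
      then have "e' \<in> E" using e' by simp
      have "s * f e' j0 = - (\<Sum>j\<in>J'. a j * (f e' j0 * f e j / f e j0))"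
        by (simp add: s_def sum_distrib_left sum_divide_distrib mult_ac)
      then show ?thesis using a(2)[OF \<open>e' \<in> E\<close>]
        by (simp add: sum_b right_diff_distrib sum_subtractf)
    qed
    moreover have "\<exists>j\<in>J. b j \<noteq> 0" using a(1) J' by (auto simp: b_def)
    ultimately show ?thesis by blast
  qed
qed

text \<open>
  With \<open>E = B\<close> a basis and \<open>f e j\<close> the image of \<open>e\<close> under the \<open>j\<close>-th of several operators, this produces
  a linear relation between operators as soon as there are more of them than the squared dimension.
\<close>

lemma (in vector_space) simultaneous_linear_relation:
  assumes "finite B" "finite E" "finite J" "card E * card B < card J"
    and f: "\<And>e j. e \<in> E \<Longrightarrow> j \<in> J \<Longrightarrow> f e j \<in> span B"
  shows "\<exists>a. (\<exists>j\<in>J. a j \<noteq> 0) \<and> (\<forall>e\<in>E. (\<Sum>j\<in>J. a j *s f e j) = 0)"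
proof -
  have "\<forall>v\<in>span B. \<exists>u. v = (\<Sum>b\<in>B. u b *s b)" using span_finite[OF \<open>finite B\<close>] by auto
  then obtain r where r: "\<And>v. v \<in> span B \<Longrightarrow> v = (\<Sum>b\<in>B. r v b *s b)" by metis
  have "card (E \<times> B) < card J" using assms by (simp add: card_cartesian_product)
  from homogeneous_system_nontrivial_solution[OF _ \<open>finite J\<close> this, of "\<lambda>(e,b) j. r (f e j) b"]
  obtain a where a: "\<exists>j\<in>J. a j \<noteq> 0"
    "\<And>e b. e \<in> E \<Longrightarrow> b \<in> B \<Longrightarrow> (\<Sum>j\<in>J. a j * r (f e j) b) = 0"
    using assms(1,2) by auto
  have "(\<Sum>j\<in>J. a j *s f e j) = 0" if e: "e \<in> E" for e
  proof -
    have "(\<Sum>j\<in>J. a j *s f e j) = (\<Sum>j\<in>J. \<Sum>b\<in>B. (a j * r (f e j) b) *s b)"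
    proof (intro sum.cong refl)
      fix j assume "j \<in> J"
      have "a j *s f e j = a j *s (\<Sum>b\<in>B. r (f e j) b *s b)" using r[OF f[OF e \<open>j \<in> J\<close>]] by simp
      then show "a j *s f e j = (\<Sum>b\<in>B. (a j * r (f e j) b) *s b)" by (simp add: scale_sum_right)
    qed
    also have "\<dots> = (\<Sum>b\<in>B. (\<Sum>j\<in>J. a j * r (f e j) b) *s b)"
      by (subst sum.swap) (simp add: scale_sum_left)
    also have "\<dots> = 0" using a(2)[OF e] by simp
    finally show ?thesis .
  qed
  then show ?thesis using a(1) by blast
qed

section \<open>Permutations of the inputs of a composite\<close>

lemma permutes_perm_pcomp:
  assumes \<sigma>: "\<sigma> permutes {1..m}" and \<tau>: "\<tau> permutes {1..n}" and i: "i \<in> {1..m}"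
  shows "perm_pcomp m n i \<sigma> \<tau> permutes {1..m + n - 1}"
proof (rule bij_imp_permutes)
  let ?p = "perm_pcomp m n i \<sigma> \<tau>" and ?S = "{1..m + n - 1}"
  have \<sigma>i: "\<sigma> j \<in> {1..m} \<longleftrightarrow> j \<in> {1..m}" for j using permutes_in_image[OF \<sigma>] .
  have \<tau>i: "\<tau> j \<in> {1..n} \<longleftrightarrow> j \<in> {1..n}" for j using permutes_in_image[OF \<tau>] .
  have \<sigma>e: "\<sigma> j = \<sigma> k \<longleftrightarrow> j = k" for j k using permutes_inj[OF \<sigma>] by (auto simp: inj_def)
  have \<tau>e: "\<tau> j = \<tau> k \<longleftrightarrow> j = k" for j k using permutes_inj[OF \<tau>] by (auto simp: inj_def)
  define out where "out j = (if j < i then j else j + 1 - n)" for j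
  have inside: "?p j = \<sigma> i + \<tau> (j + 1 - i) - 1 \<and> \<tau> (j + 1 - i) \<in> {1..n} \<and> \<sigma> i \<in> {1..m}"
    if "j \<in> ?S" "i \<le> j \<and> j < i + n" for j
    using that \<tau>i[of "j + 1 - i"] \<sigma>i[of i] i by (auto simp: perm_pcomp_def)
  have outside: "?p j = (if \<sigma> (out j) < \<sigma> i then \<sigma> (out j) else \<sigma> (out j) + n - 1)
      \<and> \<sigma> (out j) \<in> {1..m} \<and> \<sigma> (out j) \<noteq> \<sigma> i \<and> \<sigma> i \<in> {1..m}"
    if "j \<in> ?S" "\<not> (i \<le> j \<and> j < i + n)" for j
  proof -
    have "out j \<in> {1..m}" "out j \<noteq> i" using that i by (auto simp: out_def)
    then show ?thesis using that \<sigma>i \<sigma>e i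
      by (auto simp: perm_pcomp_def Let_def out_def)
  qed
  have "?p ` ?S \<subseteq> ?S"
  proof
    fix y assume "y \<in> ?p ` ?S"
    then obtain j where j: "j \<in> ?S" "y = ?p j" by auto
    show "y \<in> ?S"
    proof (cases "i \<le> j \<and> j < i + n")
      case True
      then obtain s t where "y = s + t - 1" "s \<in> {1..m}" "t \<in> {1..n}" using inside[OF j(1) True] j(2) by blast
      then show ?thesis by auto
    next
      case False
      then show ?thesis using outside[OF j(1) False] j by (auto split: if_splits)
    qed
  qed
  moreover have "inj_on ?p ?S"
  proof (rule inj_onI)
    fix j k assume jk: "j \<in> ?S" "k \<in> ?S" "?p j = ?p k"
    have out_eq: "j = k" if "out j = out k" "\<not> (i \<le> j \<and> j < i + n)" "\<not> (i \<le> k \<and> k < i + n)"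
      using that by (auto simp: out_def split: if_splits)
    have no_clash: "False" if "s + t - 1 = (if u < s then u else u + n - 1)" "t \<in> {1..n}" "u \<noteq> s" "s \<in> {1..m}" for s t u
      using that by (auto split: if_splits)
    consider "i \<le> j \<and> j < i + n" "i \<le> k \<and> k < i + n" | "i \<le> j \<and> j < i + n" "\<not> (i \<le> k \<and> k < i + n)"
      | "\<not> (i \<le> j \<and> j < i + n)" "i \<le> k \<and> k < i + n" | "\<not> (i \<le> j \<and> j < i + n)" "\<not> (i \<le> k \<and> k < i + n)" by blast
    then show "j = k"
    proof cases
      case 1
      have "s + t - 1 = s + t' - 1 \<Longrightarrow> t \<in> {1..n} \<Longrightarrow> t' \<in> {1..n} \<Longrightarrow> t = t'" for s t t' by auto
      then have "\<tau> (j + 1 - i) = \<tau> (k + 1 - i)"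
        using inside[OF jk(1) 1(1)] inside[OF jk(2) 1(2)] jk(3) by metis
      then show ?thesis using 1 by (auto simp: \<tau>e)
    next
      case 2
      then show ?thesis using inside[OF jk(1) 2(1)] outside[OF jk(2) 2(2)] jk(3) no_clash by metis
    next
      case 3
      then show ?thesis using outside[OF jk(1) 3(1)] inside[OF jk(2) 3(2)] jk(3) no_clash by metis
    next
      case 4
      then have "\<sigma> (out j) = \<sigma> (out k)"
        using outside[OF jk(1) 4(1)] outside[OF jk(2) 4(2)] jk(3) by (auto split: if_splits)
      then show ?thesis using out_eq 4 by (simp add: \<sigma>e)
    qed
  qed
  ultimately show "bij_betw ?p ?S ?S"
    by (simp add: bij_betw_def endo_inj_surj)
next
  fix x assume "x \<notin> {1..m + n - 1}"
  then show "perm_pcomp m n i \<sigma> \<tau> x = x" by (auto simp: perm_pcomp_def)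
qed

text \<open>
  Exchanging input \<open>i + 1\<close> with a block of \<open>n\<close> inputs that is attached at \<open>i\<close> is a cycle of length
  \<open>n + 1\<close>.  It is defined as a product of \<open>n\<close> transpositions, so that its effect is known once that of
  transpositions is.
\<close>

primrec block_cycle :: "nat \<Rightarrow> nat \<Rightarrow> nat \<Rightarrow> nat" where
  "block_cycle i 0 = id"
| "block_cycle i (Suc n) = block_cycle i n \<circ> transpose (i + n) (i + n + 1)"

lemma block_cycle_apply:
  "block_cycle i n j = (if i \<le> j \<and> j < i + n then j + 1 else if j = i + n then i else j)"
proof (induction n arbitrary: j)
  case (Suc n)
  consider "j = i + n" | "j = i + n + 1" | "j \<noteq> i + n" "j \<noteq> i + n + 1" by blast
  then show ?case by cases (simp_all add: Suc)
qed simp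

lemma permutes_block_cycle:
  assumes "1 \<le> i" "i + n \<le> N"
  shows "block_cycle i n permutes {1..N}"
  using assms
proof (induction n)
  case (Suc n)
  then show ?case
    unfolding block_cycle.simps by (intro permutes_compose permutes_swap_id) auto
qed (simp add: permutes_id)

lemma perm_pcomp_id_transpose:
  assumes "i \<in> {1..m}" "a \<in> {1..n}" "b \<in> {1..n}"
  shows "perm_pcomp m n i id (transpose a b) = transpose (i - 1 + a) (i - 1 + b)"
proof
  fix j
  consider "j = i - 1 + a" | "j = i - 1 + b" "a \<noteq> b" | "j \<noteq> i - 1 + a" "j \<noteq> i - 1 + b" by blast
  then show "perm_pcomp m n i id (transpose a b) j = transpose (i - 1 + a) (i - 1 + b) j"
  proof cases
    case 1
    then have "j + 1 - i = a" "j \<in> {1..m + n - 1}" "i \<le> j \<and> j < i + n" using assms by auto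
    moreover have "i + b - 1 = i - 1 + b" using assms by simp
    ultimately show ?thesis using 1 by (simp add: perm_pcomp_def)
  next
    case 2
    then have "j + 1 - i = b" "j \<in> {1..m + n - 1}" "i \<le> j \<and> j < i + n" using assms by auto
    moreover have "i + a - 1 = i - 1 + a" using assms by simp
    ultimately show ?thesis using 2 by (simp add: perm_pcomp_def)
  next
    case 3
    then have "j + 1 - i \<noteq> a" "j + 1 - i \<noteq> b" if "i \<le> j \<and> j < i + n" using that assms by auto
    then have "transpose a b (j + 1 - i) = j + 1 - i" if "i \<le> j \<and> j < i + n" using that by simp
    then show ?thesis using 3 assms by (simp add: perm_pcomp_def Let_def)
  qed
qed

lemma perm_pcomp_transpose_id:
  assumes "i \<in> {1..m}" "a \<in> {1..m}" "b \<in> {1..m}" "a \<noteq> i" "b \<noteq> i" "n \<ge> 1"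
  shows "perm_pcomp m n i (transpose a b) id =
    transpose (if a < i then a else a + n - 1) (if b < i then b else b + n - 1)"
proof
  fix j
  define pos where "pos s = (if s < i then s else s + n - 1)" for s
  define out where "out = (if j < i then j else j + 1 - n)"
  have i: "transpose a b i = i" using assms by simp
  show "perm_pcomp m n i (transpose a b) id j =
    transpose (if a < i then a else a + n - 1) (if b < i then b else b + n - 1) j"
  proof (cases "j \<in> {1..m + n - 1} \<and> \<not> (i \<le> j \<and> j < i + n)")
    case True
    then have out: "out \<noteq> i" "pos out = j" using assms by (auto simp: out_def pos_def)
    have pos_eq: "pos s = pos t \<longleftrightarrow> s = t" if "s \<noteq> i" "t \<noteq> i" for s t
      using that assms by (auto simp: pos_def)
    have "perm_pcomp m n i (transpose a b) id j = pos (transpose a b out)"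
      using True by (subst perm_pcomp_def) (auto simp: i Let_def out_def pos_def)
    also have "\<dots> = transpose (pos a) (pos b) (pos out)"
      using out(1) assms(4,5) by (simp add: transpose_def pos_eq)
    finally show ?thesis unfolding out(2) by (simp add: pos_def)
  next
    case False
    have "pos a \<in> {1..m + n - 1}" "pos b \<in> {1..m + n - 1}" using assms by (auto simp: pos_def)
    moreover have "\<not> (i \<le> pos a \<and> pos a < i + n)" "\<not> (i \<le> pos b \<and> pos b < i + n)"
      using assms by (auto simp: pos_def)
    ultimately have "transpose (pos a) (pos b) j = j" using False by (metis transpose_apply_other)
    moreover have "perm_pcomp m n i (transpose a b) id j = j" using False by (auto simp: perm_pcomp_def i)
    ultimately show ?thesis by (simp add: pos_def)
  qed
qed

lemma perm_pcomp_adjacent_transpose: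
  assumes "1 \<le> i" "i < m" "n \<ge> 1"
  shows "perm_pcomp m n i (transpose i (i + 1)) id = block_cycle i n"
proof
  fix j
  consider "j < i" | "i \<le> j" "j < i + n" | "j = i + n" | "j > i + n" by linarith
  then show "perm_pcomp m n i (transpose i (i + 1)) id j = block_cycle i n j"
  proof cases
    case 4
    then have "transpose i (i + 1) (j + 1 - n) = j + 1 - n" by simp
    then show ?thesis using 4 assms by (simp add: perm_pcomp_def block_cycle_apply Let_def)
  qed (use assms in \<open>auto simp: perm_pcomp_def block_cycle_apply Let_def\<close>)
qed

section \<open>Operads\<close>

context operad
begin

lemma space_zero: "0 \<in> op_space P n"
  and space_add: "x \<in> op_space P n \<Longrightarrow> y \<in> op_space P n \<Longrightarrow> x + y \<in> op_space P n"
  and space_diff: "x \<in> op_space P n \<Longrightarrow> y \<in> op_space P n \<Longrightarrow> x - y \<in> op_space P n"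
  and space_scale: "x \<in> op_space P n \<Longrightarrow> op_scale P c x \<in> op_space P n"
  and space_sum: "(\<And>j. j \<in> J \<Longrightarrow> f j \<in> op_space P n) \<Longrightarrow> sum f J \<in> op_space P n"
  using space_subspace[of n] by (auto intro: subspace_0 subspace_add subspace_diff subspace_scale subspace_sum)

lemma act_zero: "\<sigma> permutes {1..n} \<Longrightarrow> op_act P n 0 \<sigma> = 0"
  using act_scale[OF space_zero[of n], of \<sigma> 0] by simp

lemma act_diff:
  assumes "x \<in> op_space P n" "y \<in> op_space P n" "\<sigma> permutes {1..n}"
  shows "op_act P n (x - y) \<sigma> = op_act P n x \<sigma> - op_act P n y \<sigma>"
  using act_add[OF space_diff[OF assms(1,2)] assms(2,3)] by (simp add: algebra_simps)

lemma act_sum: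
  assumes "\<And>j. j \<in> J \<Longrightarrow> f j \<in> op_space P n" "\<sigma> permutes {1..n}"
  shows "op_act P n (sum f J) \<sigma> = (\<Sum>j\<in>J. op_act P n (f j) \<sigma>)"
  using assms by (induction J rule: infinite_finite_induct) (auto simp: act_zero act_add space_sum)

lemma comp_zero_left: "y \<in> op_space P n \<Longrightarrow> i \<in> {1..m} \<Longrightarrow> op_comp P m n i 0 y = 0"
  using comp_scale_left[OF space_zero, of y n i m 0] by simp

lemma comp_zero_right: "x \<in> op_space P m \<Longrightarrow> i \<in> {1..m} \<Longrightarrow> op_comp P m n i x 0 = 0"
  using comp_scale_right[OF _ space_zero, of x m i n 0] by simp

lemma comp_diff_left:
  assumes "x \<in> op_space P m" "x' \<in> op_space P m" "y \<in> op_space P n" "i \<in> {1..m}"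
  shows "op_comp P m n i (x - x') y = op_comp P m n i x y - op_comp P m n i x' y"
  using comp_add_left[OF space_diff[OF assms(1,2)] assms(2,3,4)] by (simp add: algebra_simps)

lemma comp_diff_right:
  assumes "x \<in> op_space P m" "y \<in> op_space P n" "y' \<in> op_space P n" "i \<in> {1..m}"
  shows "op_comp P m n i x (y - y') = op_comp P m n i x y - op_comp P m n i x y'"
  using comp_add_right[OF assms(1) space_diff[OF assms(2,3)] assms(3,4)] by (simp add: algebra_simps)

lemma comp_act_left:
  assumes "x \<in> op_space P m" "y \<in> op_space P n" "i \<in> {1..m}" "\<sigma> permutes {1..m}"
  shows "op_comp P m n i (op_act P m x \<sigma>) y =
    op_act P (m + n - 1) (op_comp P m n (\<sigma> i) x y) (perm_pcomp m n i \<sigma> id)"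
  using comp_equivariant[OF assms permutes_id] act_id[OF assms(2)] by simp

lemma comp_act_right:
  assumes "x \<in> op_space P m" "y \<in> op_space P n" "i \<in> {1..m}" "\<tau> permutes {1..n}"
  shows "op_comp P m n i x (op_act P n y \<tau>) =
    op_act P (m + n - 1) (op_comp P m n i x y) (perm_pcomp m n i id \<tau>)"
  using comp_equivariant[OF assms(1,2,3) permutes_id assms(4)] act_id[OF assms(1)] by simp

lemma comp_act_transpose_right:
  assumes "x \<in> op_space P m" "y \<in> op_space P n" "i \<in> {1..m}" "a \<in> {1..n}" "b \<in> {1..n}"
  shows "op_comp P m n i x (op_act P n y (transpose a b)) =
    op_act P (m + n - 1) (op_comp P m n i x y) (transpose (i - 1 + a) (i - 1 + b))"
  using comp_act_right[OF assms(1,2,3) permutes_swap_id[OF assms(4,5)]]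
  by (simp add: perm_pcomp_id_transpose[OF assms(3,4,5)])

text \<open>
  The commutation rule \<open>\<sigma> \<circ> (a b) = (\<sigma> a  \<sigma> b) \<circ> \<sigma>\<close>, read for a right action.
\<close>

lemma conjugate_transpose:
  assumes "x \<in> op_space P n" "\<sigma> permutes {1..n}" "a \<in> {1..n}" "b \<in> {1..n}"
  shows "op_act P n (op_act P n x \<sigma>) (transpose a b) = op_act P n (op_act P n x (transpose (\<sigma> a) (\<sigma> b))) \<sigma>"
proof -
  have "\<sigma> \<circ> transpose a b = transpose (\<sigma> a) (\<sigma> b) \<circ> \<sigma>"
    using permutes_inj[OF assms(2)] by (auto simp: fun_eq_iff transpose_def inj_def)
  moreover have "\<sigma> a \<in> {1..n}" "\<sigma> b \<in> {1..n}" using assms permutes_in_image by fastforce+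
  ultimately show ?thesis using assms by (simp add: act_act permutes_swap_id)
qed

subsection \<open>Ideals and primeness\<close>

lemma S_submodule_zero: "S_submodule P (\<lambda>_. {0})"
  by (auto simp: S_submodule_def le_fun_def space_zero act_zero)

lemma subcollection_comp_zero:
  assumes "\<And>m n i x y. x \<in> I m \<Longrightarrow> y \<in> J n \<Longrightarrow> i \<in> {1..m} \<Longrightarrow> op_comp P m n i x y = 0"
  shows "subcollection_comp P I J = (\<lambda>_. {0})"
proof (rule antisym)
  show "subcollection_comp P I J \<le> (\<lambda>_. {0})"
    unfolding subcollection_comp_def S_submodule_generated_def
    by (rule Inf_lower) (use assms S_submodule_zero in \<open>auto simp: le_fun_def\<close>)
  show "(\<lambda>_. {0}) \<le> subcollection_comp P I J"
    unfolding subcollection_comp_def S_submodule_generated_def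
    by (rule Inf_greatest) (auto simp: S_submodule_def le_fun_def subspace_0)
qed

lemma operad_idealD:
  assumes "operad_ideal P I"
  shows "x \<in> I n \<Longrightarrow> x \<in> op_space P n"
    and "x \<in> I n \<Longrightarrow> \<sigma> permutes {1..n} \<Longrightarrow> op_act P n x \<sigma> \<in> I n"
    and "x \<in> I m \<Longrightarrow> y \<in> op_space P n \<Longrightarrow> i \<in> {1..m} \<Longrightarrow> op_comp P m n i x y \<in> I (m + n - 1)"
    and "x \<in> op_space P m \<Longrightarrow> y \<in> I n \<Longrightarrow> i \<in> {1..m} \<Longrightarrow> op_comp P m n i x y \<in> I (m + n - 1)"
    and "0 \<in> I n"
  using assms unfolding operad_ideal_def S_submodule_def le_fun_def by (blast intro: subspace_0)+

text \<open>
  The analogue for left annihilators fails: if \<open>y\<close> annihilates \<open>z\<close> from the left, then \<open>u \<circ>\<^sub>i y\<close>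
  still has the inputs of \<open>u\<close>, and nothing is known about grafting \<open>z\<close> there.  On the right,
  everything is attached above \<open>y\<close> or absorbed into the ideal below it.
\<close>

lemma operad_ideal_right_annihilator:
  assumes I: "operad_ideal P I"
  shows "operad_ideal P
    (\<lambda>n. {y \<in> op_space P n. \<forall>m u i. u \<in> I m \<longrightarrow> i \<in> {1..m} \<longrightarrow> op_comp P m n i u y = 0})"
    (is "operad_ideal P ?J")
proof -
  note ID = operad_idealD[OF I]
  have "S_submodule P ?J"
    unfolding S_submodule_def
  proof (intro conjI allI impI)
    show "?J \<le> op_space P" by (auto simp: le_fun_def)
    show "subspace (?J n)" for n
      by (rule subspaceI) (auto simp: space_zero space_add space_scale comp_zero_right
          comp_add_right comp_scale_right ID(1))
    show "op_act P n x \<sigma> \<in> ?J n" if "x \<in> ?J n" "\<sigma> permutes {1..n}" for n x \<sigma>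
      using that permutes_perm_pcomp[OF permutes_id, of \<sigma> n]
      by (auto simp: act_closed comp_act_right act_zero ID(1) simp del: One_nat_def)
  qed
  moreover have "op_comp P m n i x y \<in> ?J (m + n - 1)"
    if xy: "x \<in> op_space P m" "y \<in> op_space P n" "i \<in> {1..m}" "x \<in> ?J m \<or> y \<in> ?J n" for m n i x y
  proof -
    have "op_comp P l (m + n - 1) j u (op_comp P m n i x y) = 0"
      if u: "u \<in> I l" "j \<in> {1..l}" for l j u
    proof -
      have "op_comp P l (m + n - 1) j u (op_comp P m n i x y) =
        op_comp P (l + m - 1) n (j - 1 + i) (op_comp P l m j u x) y"
        using comp_assoc_sequential[OF ID(1)[OF u(1)] xy(1,2) u(2) xy(3)] by simp
      also have "\<dots> = 0"
        using xy(4)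
      proof
        assume "x \<in> ?J m"
        then have "op_comp P l m j u x = 0" using u by blast
        then show ?thesis using u xy by (auto intro!: comp_zero_left)
      next
        assume "y \<in> ?J n"
        moreover have "op_comp P l m j u x \<in> I (l + m - 1)" using ID(3) u xy by blast
        moreover have "j - 1 + i \<in> {1..l + m - 1}" using u xy by auto
        ultimately show ?thesis by blast
      qed
      finally show ?thesis .
    qed
    then show ?thesis using comp_closed xy by auto
  qed
  ultimately show ?thesis unfolding operad_ideal_def by blast
qed

lemma prime_ideals:
  assumes "prime_operad P" "operad_ideal P I" "operad_ideal P J"
    and "\<And>m n i x y. x \<in> I m \<Longrightarrow> y \<in> J n \<Longrightarrow> i \<in> {1..m} \<Longrightarrow> op_comp P m n i x y = 0"
  shows "(\<forall>n. \<forall>x\<in>I n. x = 0) \<or> (\<forall>n. \<forall>x\<in>J n. x = 0)"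
proof -
  have "I = (\<lambda>_. {0}) \<or> J = (\<lambda>_. {0})"
    using assms subcollection_comp_zero[of I J] unfolding prime_operad_def by blast
  then show ?thesis by auto
qed

text \<open>
  The right annihilator of \<open>I\<close> is an ideal, and its product with \<open>I\<close> is zero.
\<close>

lemma prime_annihilated_imp_zero:
  assumes prime: "prime_operad P" and I: "operad_ideal P I" and x: "x \<in> I k" "x \<noteq> 0"
    and y: "y \<in> op_space P n" "\<And>m u i. u \<in> I m \<Longrightarrow> i \<in> {1..m} \<Longrightarrow> op_comp P m n i u y = 0"
  shows "y = 0"
  using prime_ideals[OF prime I operad_ideal_right_annihilator[OF I]] x y by blast

end

locale reduced_operad = operad P for P :: "('k::field, 'v::ab_group_add) operad_data" +
  assumes reduced: "reduced P"
begin

lemma arity_pos: "x \<in> op_space P n \<Longrightarrow> x \<noteq> 0 \<Longrightarrow> n \<ge> 1"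
  using reduced unfolding reduced_def by (cases n) auto

text \<open>
  Since there are no operations of arity 0, composing never lowers the arity.
\<close>

lemma operad_ideal_of_large_arities: "operad_ideal P (\<lambda>n. if n \<ge> a then op_space P n else {0})"
    (is "operad_ideal P ?I")
proof -
  have "op_comp P m n i x y \<in> ?I (m + n - 1)"
    if "x \<in> op_space P m" "y \<in> op_space P n" "i \<in> {1..m}" "x \<in> ?I m \<or> y \<in> ?I n" for m n i x y
  proof (cases "x = 0 \<or> y = 0")
    case True
    then have "op_comp P m n i x y = 0" using that comp_zero_left comp_zero_right by auto
    then show ?thesis by (auto simp: space_zero)
  next
    case False
    then have "m \<ge> 1" "n \<ge> 1" using that arity_pos by auto
    moreover have "m \<ge> a \<or> n \<ge> a" using that(4) False by (auto split: if_splits)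
    ultimately show ?thesis using comp_closed that by auto
  qed
  then show ?thesis unfolding operad_ideal_def S_submodule_def
    by (auto simp: le_fun_def space_zero space_subspace act_closed act_zero)
qed

end

locale unbounded_prime_operad = reduced_operad P for P :: "('k::field, 'v::ab_group_add) operad_data" +
  assumes prime: "prime_operad P"
    and unbounded: "\<exists>n\<ge>a. \<exists>x\<in>op_space P n. x \<noteq> 0"
begin

lemma large_arity_faithful:
  assumes "z \<in> op_space P l" "\<And>n y i. n \<ge> a \<Longrightarrow> y \<in> op_space P n \<Longrightarrow> i \<in> {1..n} \<Longrightarrow> op_comp P n l i y z = 0"
  shows "z = 0"
proof -
  obtain n x where x: "n \<ge> a" "x \<in> op_space P n" "x \<noteq> 0" using unbounded by blast
  show ?thesis
  proof (rule prime_annihilated_imp_zero[OF prime operad_ideal_of_large_arities[of a], where x = x and k = n])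
    show "x \<in> (if a \<le> n then op_space P n else {0})" "x \<noteq> 0" using x by auto
    show "z \<in> op_space P l" by fact
    show "op_comp P m l i u z = 0" if "u \<in> (if a \<le> m then op_space P m else {0})" "i \<in> {1..m}" for m u i
      using that assms comp_zero_left by (auto split: if_splits)
  qed
qed

end

subsection \<open>Growing a composite one generator at a time\<close>

context operad
begin

text \<open>
  Every element of the operad generated by \<open>X\<close> is a combination of relabelled trees, and a tree is
  built from the trivial tree by grafting one generator at a time onto a leaf.  That a whole tree can be
  grafted at once follows by induction over the second factor, which is what the auxiliary collection
  \<open>S\<close> records.
\<close>

lemma graft_induct [consumes 2, case_names mem unit add scale act graft zero]:
  assumes gen: "suboperad_generated P X = op_space P" and x: "x \<in> op_space P n"
    and X: "X \<le> op_space P"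
    and Q_unit: "Q 1 (op_unit P)"
    and Q_add: "\<And>n x y. x \<in> op_space P n \<Longrightarrow> y \<in> op_space P n \<Longrightarrow> Q n x \<Longrightarrow> Q n y \<Longrightarrow> Q n (x + y)"
    and Q_scale: "\<And>n c x. x \<in> op_space P n \<Longrightarrow> Q n x \<Longrightarrow> Q n (op_scale P c x)"
    and Q_act: "\<And>n x \<sigma>. x \<in> op_space P n \<Longrightarrow> Q n x \<Longrightarrow> \<sigma> permutes {1..n} \<Longrightarrow> Q n (op_act P n x \<sigma>)"
    and Q_graft: "\<And>m n x g i. x \<in> op_space P m \<Longrightarrow> Q m x \<Longrightarrow> g \<in> X n \<Longrightarrow> i \<in> {1..m} \<Longrightarrow>
      Q (m + n - 1) (op_comp P m n i x g)"
    and Q_zero: "\<And>n. Q n 0"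
  shows "Q n x"
proof -
  define R where "R n = {x \<in> op_space P n. Q n x}" for n
  define S where "S n = {y \<in> op_space P n. \<forall>m x i. x \<in> R m \<longrightarrow> i \<in> {1..m} \<longrightarrow>
    op_comp P m n i x y \<in> R (m + n - 1)}" for n
  have R_act: "op_act P n x \<sigma> \<in> R n" if "x \<in> R n" "\<sigma> permutes {1..n}" for n x \<sigma>
    using that by (auto simp: R_def act_closed Q_act)
  have "suboperad P S"
    unfolding suboperad_def S_submodule_def
  proof (intro conjI allI impI)
    show "S \<le> op_space P" by (auto simp: S_def le_fun_def)
    show "subspace (S n)" for n
      by (rule subspaceI) (auto simp: S_def R_def space_zero space_add space_scale comp_zero_right
          comp_add_right comp_scale_right Q_zero Q_add Q_scale)
    show "op_act P n y \<sigma> \<in> S n" if "y \<in> S n" "\<sigma> permutes {1..n}" for n y \<sigma>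
    proof -
      have "op_comp P m n i x (op_act P n y \<sigma>) \<in> R (m + n - 1)" if "x \<in> R m" "i \<in> {1..m}" for m x i
      proof -
        have "x \<in> op_space P m" using that by (simp add: R_def)
        then show ?thesis
          using that \<open>y \<in> S n\<close> \<open>\<sigma> permutes _\<close> R_act[OF _ permutes_perm_pcomp[OF permutes_id]]
          by (auto simp: S_def comp_act_right)
      qed
      then show ?thesis using that by (simp add: S_def act_closed)
    qed
    show "op_unit P \<in> S 1" using unit_closed by (auto simp: S_def R_def comp_unit simp del: One_nat_def)
    show "op_comp P m n i x y \<in> S (m + n - 1)" if "x \<in> S m" "y \<in> S n" "i \<in> {1..m}" for m n i x y
    proof -
      have xy: "x \<in> op_space P m" "y \<in> op_space P n" using that by (auto simp: S_def)
      have "op_comp P l (m + n - 1) j u (op_comp P m n i x y) \<in> R (l + (m + n - 1) - 1)"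
        if u: "u \<in> R l" "j \<in> {1..l}" for l u j
      proof -
        have "u \<in> op_space P l" using u by (simp add: R_def)
        then have eq: "op_comp P l (m + n - 1) j u (op_comp P m n i x y) =
          op_comp P (l + m - 1) n (j - 1 + i) (op_comp P l m j u x) y"
          using comp_assoc_sequential[OF _ xy u(2) \<open>i \<in> {1..m}\<close>] by simp
        have "op_comp P l m j u x \<in> R (l + m - 1)" using u \<open>x \<in> S m\<close> by (auto simp: S_def)
        moreover have "j - 1 + i \<in> {1..l + m - 1}" using u \<open>i \<in> _\<close> by auto
        ultimately have "op_comp P (l + m - 1) n (j - 1 + i) (op_comp P l m j u x) y \<in> R (l + m - 1 + n - 1)"
          using \<open>y \<in> S n\<close> by (auto simp: S_def)
        moreover have "l + m - 1 + n - 1 = l + (m + n - 1) - 1" using u \<open>i \<in> _\<close> by auto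
        ultimately show ?thesis using eq by simp
      qed
      then show ?thesis using comp_closed[OF xy] that by (auto simp: S_def)
    qed
  qed
  moreover have "X \<le> S"
    using X by (auto simp: le_fun_def S_def R_def comp_closed Q_graft subset_iff simp del: One_nat_def)
  ultimately have "suboperad_generated P X \<le> S"
    unfolding suboperad_generated_def by (intro Inf_lower) auto
  then have "x \<in> S n" using x gen by (auto simp: le_fun_def)
  moreover have "op_unit P \<in> R 1" using unit_closed Q_unit by (simp add: R_def del: One_nat_def)
  ultimately have "op_comp P 1 n 1 (op_unit P) x \<in> R (1 + n - 1)" unfolding S_def by fastforce
  then show ?thesis using unit_comp[OF x] by (simp add: R_def)
qed

end

context reduced_operad
begin

text \<open>
  Consider a tree of generators of arity at least \<open>a\<close> with \<open>z\<close> attached at a leaf.  The connected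
  subtrees that contain the vertex carrying \<open>z\<close> can be enlarged one vertex at a time, and every step raises the
  arity by at most \<open>d - 1\<close>, so one of them has its arity in the window and kills \<open>z\<close>.

  In the induction a growing tree is split as \<open>y \<circ>\<^sub>j w\<close>, where \<open>w\<close> is a subtree that already carries \<open>z\<close>
  and still has small arity.  When a generator is removed from \<open>y\<close>, it is either a vertex away from \<open>w\<close>, in
  which case the tree is pruned, or the vertex just below \<open>w\<close>, in which case it is moved to \<open>w\<close>.
\<close>

lemma annihilated_window_imp_annihilated:
  assumes gen: "suboperad_generated P X = op_space P" and X: "X \<le> op_space P"
    and d: "\<And>n g. g \<in> X n \<Longrightarrow> n \<le> d" and "d \<ge> 1" and "a \<ge> 1"
    and z: "z \<in> op_space P k"
    and window: "\<And>n y i. n \<in> {a..<a+d} \<Longrightarrow> y \<in> op_space P n \<Longrightarrow> i \<in> {1..n} \<Longrightarrow> op_comp P n k i y z = 0"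
    and y: "n \<ge> a" "y \<in> op_space P n" "i \<in> {1..n}"
  shows "op_comp P n k i y z = 0"
proof -
  define Q where "Q n y \<longleftrightarrow> (\<forall>l w i j. w \<in> op_space P l \<longrightarrow> l < a + d \<longrightarrow> i \<in> {1..l} \<longrightarrow> j \<in> {1..n} \<longrightarrow>
     n + l - 1 \<ge> a \<longrightarrow> op_comp P n (l + k - 1) j y (op_comp P l k i w z) = 0)" for n y
  have wz: "op_comp P l k i w z \<in> op_space P (l + k - 1)" if "w \<in> op_space P l" "i \<in> {1..l}" for l i w
    using comp_closed that z by blast
  have "Q n y"
    using gen y(2)
  proof (induction rule: graft_induct)
    case mem
    show ?case by (rule X)
  next
    case unit
    show ?case unfolding Q_def
    proof (intro allI impI)
      fix l w i j
      assume w: "w \<in> op_space P l" "l < a + d" "i \<in> {1..l}" "j \<in> {1..1::nat}" "a \<le> 1 + l - 1"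
      have "op_comp P 1 (l + k - 1) 1 (op_unit P) (op_comp P l k i w z) = op_comp P l k i w z"
        by (rule unit_comp[OF wz[OF w(1,3)]])
      then show "op_comp P 1 (l + k - 1) j (op_unit P) (op_comp P l k i w z) = 0"
        using window[OF _ w(1,3)] w by simp
    qed
  next
    case (add n x y)
    then show ?case unfolding Q_def using wz by (auto simp: comp_add_left)
  next
    case (scale n c x)
    then show ?case unfolding Q_def using wz by (auto simp: comp_scale_left)
  next
    case (act n x \<sigma>)
    show ?case unfolding Q_def
    proof (intro allI impI)
      fix l w i j
      assume w: "w \<in> op_space P l" "l < a + d" "i \<in> {1..l}" "j \<in> {1..n}" "a \<le> n + l - 1"
      have "\<sigma> j \<in> {1..n}" using permutes_in_image[OF act(2)] w(4) by blast
      then have "op_comp P n (l + k - 1) (\<sigma> j) x (op_comp P l k i w z) = 0"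
        using act(3) w unfolding Q_def by blast
      then show "op_comp P n (l + k - 1) j (op_act P n x \<sigma>) (op_comp P l k i w z) = 0"
        using comp_act_left[OF act(1) wz[OF w(1,3)] w(4) act(2)]
          act_zero[OF permutes_perm_pcomp[OF act(2) permutes_id w(4)]] by simp
    qed
  next
    case (graft p r x g q)
    have g: "g \<in> op_space P r" "r \<le> d" using graft X d by (auto simp: le_fun_def)
    have xg: "op_comp P p r q x g \<in> op_space P (p + r - 1)" using comp_closed graft g by blast
    show ?case unfolding Q_def
    proof (intro allI impI)
      fix l w i j
      assume w: "w \<in> op_space P l" "l < a + d" "i \<in> {1..l}" "j \<in> {1..p + r - 1}" "a \<le> p + r - 1 + l - 1"
      define u where "u = op_comp P l k i w z"
      have u: "u \<in> op_space P (l + k - 1)" using wz w by (simp add: u_def)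
      have IH: "op_comp P p (l' + k - 1) j' x (op_comp P l' k i' w' z) = 0"
        if "w' \<in> op_space P l'" "l' < a + d" "i' \<in> {1..l'}" "j' \<in> {1..p}" "p + l' - 1 \<ge> a" for l' w' i' j'
        using graft(4) that unfolding Q_def by blast
      show "op_comp P (p + r - 1) (l + k - 1) j (op_comp P p r q x g) (op_comp P l k i w z) = 0"
      proof (cases "g = 0")
        case True
        then show ?thesis using graft wz w by (simp add: comp_zero_right comp_zero_left)
      next
        case g0: False
        then have r: "r \<ge> 1" using arity_pos g by blast
        have p: "p \<ge> 1" and l: "l \<ge> 1" using graft w by auto
        show ?thesis
        \<comment> \<open>The arity of the whole tree is at least \<open>a\<close>; if it lies in the window, there is nothing to prune.\<close>
        proof (cases "p + r - 1 + l - 1 < a + d")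
          case True
          have "op_comp P (p + r - 1 + l - 1) k (j - 1 + i) (op_comp P (p + r - 1) l j (op_comp P p r q x g) w) z = 0"
            by (rule window) (use True w comp_closed xg in auto)
          then show ?thesis using comp_assoc_sequential[OF xg w(1) z w(4,3)] by simp
        next
          case large: False
          \<comment> \<open>Removing \<open>g\<close> lowers the arity by at most \<open>d - 1\<close>, so what remains still has arity at least \<open>a\<close>.\<close>
          then have large': "a \<le> p + l - 1" using g by linarith
          consider "j < q" | "q \<le> j" "j < q + r" | "j \<ge> q + r" by linarith
          then show ?thesis
          proof cases
            case 1
            then have jp: "j \<in> {1..p}" using w graft by auto
            have "op_comp P p (l + k - 1) j x u = 0" unfolding u_def by (rule IH) (use w jp large' in auto)
            moreover have "q - 1 + (l + k - 1) \<in> {1..p + (l + k - 1) - 1}" using jp graft(3) 1 by auto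
            ultimately show ?thesis
              using comp_assoc_parallel[OF graft(1) u g(1) jp graft(3) 1] comp_zero_left[OF g(1)]
              by (simp add: u_def)
          next
            case 2
            \<comment> \<open>Here \<open>w\<close> sits on an input of \<open>g\<close>, and \<open>g\<close> passes to the subtree that carries \<open>z\<close>.\<close>
            define j' where "j' = j + 1 - q"
            have j': "j' \<in> {1..r}" "j = q - 1 + j'" using 2 graft by (auto simp: j'_def)
            have "op_comp P (p + r - 1) (l + k - 1) j (op_comp P p r q x g) u =
              op_comp P p (r + (l + k - 1) - 1) q x (op_comp P r (l + k - 1) j' g u)"
              unfolding j'(2) by (rule comp_assoc_sequential[OF graft(1) g(1) u graft(3) j'(1)])
            also have "op_comp P r (l + k - 1) j' g u =
              op_comp P (r + l - 1) k (j' - 1 + i) (op_comp P r l j' g w) z"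
              unfolding u_def by (rule comp_assoc_sequential[OF g(1) w(1) z j'(1) w(3), symmetric])
            also have "op_comp P p (r + (l + k - 1) - 1) q x \<dots> = 0"
            proof (cases "l \<ge> a")
              case True
              then have "u = 0" unfolding u_def using window w by auto
              then have "op_comp P r (l + k - 1) j' g u = 0" using comp_zero_right g j' by blast
              then show ?thesis
                using comp_assoc_sequential[OF g(1) w(1) z j'(1) w(3)] graft comp_zero_right
                by (simp add: u_def)
            next
              case False
              have "op_comp P p (r + l - 1 + k - 1) q x
                (op_comp P (r + l - 1) k (j' - 1 + i) (op_comp P r l j' g w) z) = 0"
                by (rule IH) (use False g w j' graft large r comp_closed in auto)
              moreover have "r + (l + k - 1) - 1 = r + l - 1 + k - 1" using r l by simp
              ultimately show ?thesis by simp
            qed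
            finally show ?thesis by (simp add: u_def)
          next
            case 3
            define j' where "j' = j + 1 - r"
            have j': "j' \<in> {1..p}" "q < j'" "j = j' - 1 + r" using 3 graft w r by (auto simp: j'_def)
            have "op_comp P p (l + k - 1) j' x u = 0" unfolding u_def by (rule IH) (use w j' large' in auto)
            moreover have "q \<in> {1..p + (l + k - 1) - 1}" using j' graft l by auto
            ultimately show ?thesis
              using comp_assoc_parallel[OF graft(1) g(1) u graft(3) j'(1,2)] g
              by (simp add: u_def comp_zero_left j'(3))
          qed
        qed
      qed
    qed
  qed (auto simp: Q_def comp_zero_left wz simp del: One_nat_def)
  \<comment> \<open>Start with the trivial tree as the subtree that carries \<open>z\<close>.\<close>
  moreover have "op_comp P 1 k 1 (op_unit P) z = z" using unit_comp z by blast
  moreover have "1 < a + d" using \<open>d \<ge> 1\<close> \<open>a \<ge> 1\<close> by simp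
  ultimately show ?thesis using y unit_closed unfolding Q_def
    by (metis add_diff_cancel_left' add_diff_cancel_right' atLeastAtMost_singleton singletonI)
qed

end

section \<open>Transpositions\<close>

context operad
begin

lemma finite_basis:
  assumes "locally_finite P"
  obtains B where "finite B" "B \<subseteq> op_space P n" "span B = op_space P n" "card B = dim (op_space P n)"
proof -
  obtain C where C: "finite C" "C \<subseteq> op_space P n" "span C = op_space P n"
    using assms unfolding locally_finite_def by blast
  obtain B where B: "B \<subseteq> op_space P n" "independent B" "op_space P n \<subseteq> span B" "card B = dim (op_space P n)"
    using basis_exists by blast
  have "finite B" using independent_span_bound[OF C(1) B(2)] B(1) C(3) by simp
  moreover have "span B = op_space P n"
    using B(1,3) span_minimal[OF B(1) space_subspace] by auto
  ultimately show ?thesis using that B by blast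
qed

lemma dim_pos:
  assumes "locally_finite P" "x \<in> op_space P n" "x \<noteq> 0"
  shows "dim (op_space P n) \<ge> 1"
proof -
  obtain B where B: "finite B" "span B = op_space P n" "card B = dim (op_space P n)"
    using finite_basis[OF assms(1)] by metis
  then have "B \<noteq> {}" using assms by auto
  then show ?thesis using B by (simp add: card_gt_0_iff Suc_leI flip: B(3))
qed

text \<open>
  The operators \<open>(a j)\<close> for \<open>j \<noteq> a, c\<close> are linearly independent.  Indeed, conjugating a relation between
  them by \<open>(j0 c)\<close> changes only the term \<open>(a j0)\<close>, which becomes \<open>(a c)\<close>.  Subtracting, a nonzero coefficient at
  \<open>j0\<close> forces \<open>(a j0)\<close> and \<open>(a c)\<close> to act equally on the whole component, and conjugating by
  \<open>(j0 b)\<close> the same follows for \<open>(a b)\<close> and \<open>(a c)\<close>.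
\<close>

lemma dim_ge_of_differing_transpositions:
  assumes lf: "locally_finite P" and v: "v \<in> op_space P n"
    and abc: "a \<in> {1..n}" "b \<in> {1..n}" "c \<in> {1..n}" "a \<noteq> b" "a \<noteq> c" "b \<noteq> c"
    and ne: "op_act P n v (transpose a b) \<noteq> op_act P n v (transpose a c)"
  shows "n - 2 \<le> (dim (op_space P n))\<^sup>2"
proof (rule ccontr)
  assume small: "\<not> ?thesis"
  obtain B where B: "finite B" "B \<subseteq> op_space P n" "span B = op_space P n" "card B = dim (op_space P n)"
    using finite_basis[OF lf] .
  define J where "J = {1..n} - {a, c}"
  have J: "finite J" "card J = n - 2" "J \<subseteq> {1..n}" "a \<notin> J" "c \<notin> J"
    using abc by (auto simp: J_def card_Diff_subset)
  have perm: "transpose x y permutes {1..n}" if "x \<in> {1..n}" "y \<in> {1..n}" for x y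
    using that by (rule permutes_swap_id)
  have "card B * card B < card J" using small B(4) J(2) by (simp add: power2_eq_square)
  moreover have "op_act P n e (transpose a j) \<in> span B" if "e \<in> B" "j \<in> J" for e j
    unfolding B(3) using that B(2) J(3) abc(1) by (intro act_closed perm) auto
  ultimately obtain \<alpha> where \<alpha>: "\<exists>j\<in>J. \<alpha> j \<noteq> 0"
    "\<And>e. e \<in> B \<Longrightarrow> (\<Sum>j\<in>J. op_scale P (\<alpha> j) (op_act P n e (transpose a j))) = 0"
    using simultaneous_linear_relation[OF B(1) B(1) J(1), of "\<lambda>e j. op_act P n e (transpose a j)"] by blast
  let ?S = "{x \<in> op_space P n. (\<Sum>j\<in>J. op_scale P (\<alpha> j) (op_act P n x (transpose a j))) = 0}"
  have "subspace ?S"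
  proof (rule subspaceI)
    show "0 \<in> ?S" using J perm abc by (auto simp: space_zero act_zero subset_iff intro!: sum.neutral)
  next
    fix x y assume "x \<in> ?S" "y \<in> ?S"
    moreover have "(\<Sum>j\<in>J. op_scale P (\<alpha> j) (op_act P n (x + y) (transpose a j))) =
      (\<Sum>j\<in>J. op_scale P (\<alpha> j) (op_act P n x (transpose a j))) +
      (\<Sum>j\<in>J. op_scale P (\<alpha> j) (op_act P n y (transpose a j)))"
      unfolding sum.distrib[symmetric]
      using calculation J perm abc by (intro sum.cong refl) (auto simp: act_add scale_right_distrib subset_iff)
    ultimately show "x + y \<in> ?S" by (simp add: space_add)
  next
    fix r x assume "x \<in> ?S"
    moreover have "(\<Sum>j\<in>J. op_scale P (\<alpha> j) (op_act P n (op_scale P r x) (transpose a j))) =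
      op_scale P r (\<Sum>j\<in>J. op_scale P (\<alpha> j) (op_act P n x (transpose a j)))"
      unfolding scale_sum_right
      using calculation J perm abc
      by (intro sum.cong refl) (auto simp: act_scale scale_left_commute subset_iff)
    ultimately show "op_scale P r x \<in> ?S" by (simp add: space_scale)
  qed
  moreover have "B \<subseteq> ?S" using B(2) \<alpha>(2) by auto
  ultimately have "span B \<subseteq> ?S" by (rule span_minimal[rotated])
  then have rel: "(\<Sum>j\<in>J. op_scale P (\<alpha> j) (op_act P n x (transpose a j))) = 0" if "x \<in> op_space P n" for x
    using that B(3) by auto
  obtain j0 where j0: "j0 \<in> J" "\<alpha> j0 \<noteq> 0" using \<alpha>(1) by blast
  have j0': "j0 \<in> {1..n}" "j0 \<noteq> a" "j0 \<noteq> c" using j0 J by auto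
  define \<tau> where "\<tau> = transpose j0 c"
  have \<tau>: "\<tau> permutes {1..n}" "\<tau> a = a" "\<tau> \<circ> \<tau> = id" using perm[OF j0'(1) abc(3)] j0' abc by (auto simp: \<tau>_def)
  have collapse: "op_act P n x (transpose a j0) = op_act P n x (transpose a c)" if x: "x \<in> op_space P n" for x
  proof -
    have x\<tau>: "op_act P n x \<tau> \<in> op_space P n" using x \<tau> act_closed by blast
    have conj: "op_act P n (op_act P n (op_act P n x \<tau>) (transpose a j)) \<tau> = op_act P n x (transpose a (\<tau> j))"
      if "j \<in> J" for j
    proof -
      have j: "j \<in> {1..n}" "\<tau> j \<in> {1..n}" using that J permutes_in_image[OF \<tau>(1)] by auto
      have "op_act P n (op_act P n x \<tau>) (transpose a j) = op_act P n (op_act P n x (transpose a (\<tau> j))) \<tau>"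
        using conjugate_transpose[OF x \<tau>(1) abc(1) j(1)] \<tau>(2) by simp
      then show ?thesis
        using act_act[OF act_closed[OF x perm[OF abc(1) j(2)]] \<tau>(1) \<tau>(1)]
          act_id[OF act_closed[OF x perm[OF abc(1) j(2)]]] \<tau>(3) by simp
    qed
    have inJ: "op_scale P (\<alpha> j) (op_act P n (op_act P n x \<tau>) (transpose a j)) \<in> op_space P n" if "j \<in> J" for j
      using that J abc perm act_closed[OF x\<tau>] space_scale by blast
    have "0 = op_act P n (\<Sum>j\<in>J. op_scale P (\<alpha> j) (op_act P n (op_act P n x \<tau>) (transpose a j))) \<tau>"
      using rel[OF x\<tau>] act_zero[OF \<tau>(1)] by simp
    also have "\<dots> = (\<Sum>j\<in>J. op_act P n (op_scale P (\<alpha> j) (op_act P n (op_act P n x \<tau>) (transpose a j))) \<tau>)"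
      using inJ \<tau>(1) by (rule act_sum)
    also have "\<dots> = (\<Sum>j\<in>J. op_scale P (\<alpha> j) (op_act P n x (transpose a (\<tau> j))))"
    proof (intro sum.cong refl)
      fix j assume "j \<in> J"
      then have "op_act P n (op_act P n x \<tau>) (transpose a j) \<in> op_space P n"
        using J abc perm act_closed[OF x\<tau>] by blast
      then show "op_act P n (op_scale P (\<alpha> j) (op_act P n (op_act P n x \<tau>) (transpose a j))) \<tau> =
        op_scale P (\<alpha> j) (op_act P n x (transpose a (\<tau> j)))"
        using act_scale[OF _ \<tau>(1)] conj[OF \<open>j \<in> J\<close>] by simp
    qed
    finally have "0 = (\<Sum>j\<in>J. op_scale P (\<alpha> j) (op_act P n x (transpose a j))) -
        (\<Sum>j\<in>J. op_scale P (\<alpha> j) (op_act P n x (transpose a (\<tau> j))))"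
      using rel[OF x] by simp
    also have "\<dots> = (\<Sum>j\<in>J. if j = j0 then op_scale P (\<alpha> j0) (op_act P n x (transpose a j0) -
        op_act P n x (transpose a c)) else 0)"
      unfolding sum_subtractf[symmetric]
    proof (intro sum.cong refl)
      fix j assume "j \<in> J"
      then have "j \<noteq> c" using J by blast
      then show "op_scale P (\<alpha> j) (op_act P n x (transpose a j)) -
          op_scale P (\<alpha> j) (op_act P n x (transpose a (\<tau> j))) =
        (if j = j0 then op_scale P (\<alpha> j0) (op_act P n x (transpose a j0) - op_act P n x (transpose a c)) else 0)"
        by (auto simp: \<tau>_def scale_right_diff_distrib)
    qed
    also have "\<dots> = op_scale P (\<alpha> j0) (op_act P n x (transpose a j0) - op_act P n x (transpose a c))"
      using j0 J(1) by simp
    finally show ?thesis using j0(2) scale_eq_0_iff by (metis right_minus_eq)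
  qed
  have "op_act P n v (transpose a b) = op_act P n v (transpose a c)"
  proof -
    define \<rho> where "\<rho> = transpose j0 b"
    have \<rho>: "\<rho> permutes {1..n}" "\<rho> a = a" "\<rho> j0 = b" "\<rho> c = c" "\<rho> \<circ> \<rho> = id"
      using perm[OF j0'(1) abc(2)] j0' abc by (auto simp: \<rho>_def)
    have undo: "op_act P n (op_act P n w \<rho>) \<rho> = w" if "w \<in> op_space P n" for w
      using act_act[OF that \<rho>(1) \<rho>(1)] act_id[OF that] \<rho>(5) by simp
    have "op_act P n (op_act P n v (transpose a b)) \<rho> = op_act P n (op_act P n v (transpose a c)) \<rho>"
      using collapse[OF act_closed[OF v \<rho>(1)]] conjugate_transpose[OF v \<rho>(1) abc(1) j0'(1)]
        conjugate_transpose[OF v \<rho>(1) abc(1) abc(3)] \<rho> by simp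
    then show ?thesis using undo act_closed[OF v perm] abc by metis
  qed
  then show False using ne by contradiction
qed

end

context unbounded_prime_operad
begin

text \<open>
  The crucial point is that \<open>y \<circ>\<^sub>i z\<close> has the same shape as \<open>z = v * (a b) - v * (a c)\<close>, with the points
  shifted by \<open>i - 1\<close>.  A nonzero \<open>z\<close> thus produces components of large dimension with bounded gaps.
\<close>

lemma transpositions_sharing_a_point_act_equally:
  assumes lf: "locally_finite P" and fg: "finitely_generated P" and gk: "GKdim P = 1"
    and v: "v \<in> op_space P k"
    and abc: "a \<in> {1..k}" "b \<in> {1..k}" "c \<in> {1..k}" "a \<noteq> b" "a \<noteq> c" "b \<noteq> c"
  shows "op_act P k v (transpose a b) = op_act P k v (transpose a c)"
proof (rule ccontr)
  assume ne: "\<not> ?thesis"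
  obtain X where X: "X \<le> op_space P" "finite (SIGMA n:UNIV. X n)" "suboperad_generated P X = op_space P"
    using fg unfolding finitely_generated_def by blast
  have "finite (fst ` (SIGMA n:UNIV. X n))" using X(2) by simp
  then obtain d0 where "\<And>n. n \<in> fst ` (SIGMA n:UNIV. X n) \<Longrightarrow> n \<le> d0" using finite_nat_set_iff_bounded_le by metis
  then have d0: "n \<le> d0" if "g \<in> X n" for n g using that by force
  define d where "d = max 1 d0"
  have d: "d \<ge> 1" "\<And>n g. g \<in> X n \<Longrightarrow> n \<le> d" unfolding d_def using d0 by (simp, meson max.coboundedI2)
  define z where "z = op_act P k v (transpose a b) - op_act P k v (transpose a c)"
  have perm: "transpose x y permutes {1..n}" if "x \<in> {1..n}" "y \<in> {1..n}" for x y n :: nat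
    using that by (rule permutes_swap_id)
  have zs: "op_act P k v (transpose a b) \<in> op_space P k" "op_act P k v (transpose a c) \<in> op_space P k"
    using act_closed v perm abc by auto
  have z: "z \<in> op_space P k" "z \<noteq> 0" using space_diff zs ne by (auto simp: z_def)
  have k: "k \<ge> 1" using arity_pos[OF z] .
  have hit: "\<exists>n\<in>{A..<A+d}. \<exists>y\<in>op_space P n. \<exists>i\<in>{1..n}. op_comp P n k i y z \<noteq> 0" if "A \<ge> 1" for A
  proof (rule ccontr)
    assume none: "\<not> ?thesis"
    have "op_comp P n k i y z = 0" if "n \<ge> A" "y \<in> op_space P n" "i \<in> {1..n}" for n y i
      by (rule annihilated_window_imp_annihilated[OF X(3,1) _ d(1) \<open>A \<ge> 1\<close> z(1) _ that])
        (use none d(2) in blast)+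
    then show False using large_arity_faithful[OF z(1)] z(2) by blast
  qed
  have "\<exists>N\<in>{A..<A+(d+k)}. N \<le> 3 * (dim (op_space P N))\<^sup>2" if "A \<ge> 1" for A
  proof -
    \<comment> \<open>The arity \<open>n + k - 1\<close> of \<open>y \<circ>\<^sub>i z\<close> is never below \<open>k\<close>; for \<open>A < k\<close> it is therefore sought from \<open>k\<close> on,
      and the window has length \<open>d + k\<close> rather than \<open>d\<close>.\<close>
    obtain n y i where y: "n \<in> {max 1 (A + 1 - k)..<max 1 (A + 1 - k) + d}" "y \<in> op_space P n" "i \<in> {1..n}"
      "op_comp P n k i y z \<noteq> 0"
      using hit[of "max 1 (A + 1 - k)"] by auto
    define N where "N = n + k - 1"
    have N: "N \<in> {A..<A+(d+k)}" using y(1) k that by (auto simp: N_def)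
    define w where "w = op_comp P n k i y v"
    have w: "w \<in> op_space P N" using comp_closed y v by (simp add: w_def N_def)
    have yz: "op_comp P n k i y z =
      op_act P N w (transpose (i - 1 + a) (i - 1 + b)) - op_act P N w (transpose (i - 1 + a) (i - 1 + c))"
      unfolding z_def w_def N_def
      using comp_diff_right[OF y(2) zs y(3)] comp_act_transpose_right[OF y(2) v y(3) abc(1,2)]
        comp_act_transpose_right[OF y(2) v y(3) abc(1,3)] by simp
    have in_N: "i - 1 + x \<in> {1..N}" if "x \<in> {1..k}" for x using that y(3) by (auto simp: N_def)
    have "N - 2 \<le> (dim (op_space P N))\<^sup>2"
      by (rule dim_ge_of_differing_transpositions[OF lf w in_N[OF abc(1)] in_N[OF abc(2)] in_N[OF abc(3)]])
        (use abc y(4) yz in auto)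
    moreover have "dim (op_space P N) \<ge> 1"
      using dim_pos[OF lf _ y(4)] comp_closed[OF y(2) z(1) y(3)] by (simp add: N_def)
    then have "(dim (op_space P N))\<^sup>2 \<ge> 1" by simp
    ultimately show ?thesis using N by (intro bexI[of _ N]) linarith+
  qed
  moreover obtain A where "A \<ge> 1" "\<forall>n\<in>{A..<A+(d+k)}. n > 3 * (dim (op_space P n))\<^sup>2"
    using growth_one_imp_small_window[OF gk[unfolded GKdim_def], of "d + k" 3] d(1) by auto
  ultimately show False by (meson leD)
qed

lemma transpositions_act_equally:
  assumes "locally_finite P" "finitely_generated P" "GKdim P = 1"
    and v: "v \<in> op_space P n" and ab: "a \<in> {1..n}" "b \<in> {1..n}" "a \<noteq> b"
  shows "op_act P n v (transpose a b) = op_act P n v (transpose 1 2)"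
proof -
  note share = transpositions_sharing_a_point_act_equally[OF assms(1-3) v]
  have n: "1 \<in> {1..n}" "2 \<in> {1..n}" using ab by auto
  have one: "op_act P n v (transpose 1 x) = op_act P n v (transpose 1 2)" if "x \<in> {1..n}" "x \<noteq> 1" for x
    using share[of 1 x 2] that n by (cases "x = 2") auto
  show ?thesis
  proof (cases "a = 1 \<or> b = 1")
    case True
    then show ?thesis using one ab by (metis transpose_commute)
  next
    case False
    then have "op_act P n v (transpose a b) = op_act P n v (transpose a 1)" using share[of a b 1] ab n by auto
    also have "\<dots> = op_act P n v (transpose 1 2)" using one[of a] ab False by (metis transpose_commute)
    finally show ?thesis .
  qed
qed

end

text \<open>
  If all transpositions act in the same way, then even permutations act trivially; what remains is an
  action of the group of order two on every component.
\<close>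

locale alternating_trivial_operad = unbounded_prime_operad P for P :: "('k::field, 'v::ab_group_add) operad_data" +
  assumes act_transpose: "x \<in> op_space P n \<Longrightarrow> a \<in> {1..n} \<Longrightarrow> b \<in> {1..n} \<Longrightarrow> a \<noteq> b \<Longrightarrow>
    op_act P n x (transpose a b) = op_act P n x (transpose 1 2)"
begin

definition swap :: "nat \<Rightarrow> 'v \<Rightarrow> 'v" where
  "swap n x = op_act P n x (transpose 1 2)"

lemma transpose_1_2_permutes: "n \<ge> 2 \<Longrightarrow> transpose 1 2 permutes {1..n::nat}"
  by (rule permutes_swap_id) auto

lemma swap_closed: "x \<in> op_space P n \<Longrightarrow> n \<ge> 2 \<Longrightarrow> swap n x \<in> op_space P n"
  unfolding swap_def by (rule act_closed) (auto intro: transpose_1_2_permutes[simplified])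

lemma swap_swap: "x \<in> op_space P n \<Longrightarrow> n \<ge> 2 \<Longrightarrow> swap n (swap n x) = x"
  unfolding swap_def using act_act[OF _ transpose_1_2_permutes transpose_1_2_permutes] act_id by simp

lemma swap_act:
  assumes "x \<in> op_space P n" "n \<ge> 2" "\<sigma> permutes {1..n}"
  shows "op_act P n (swap n x) \<sigma> = swap n (op_act P n x \<sigma>)"
proof -
  have 12: "1 \<in> {1..n}" "2 \<in> {1..n}" using assms(2) by auto
  have "swap n (op_act P n x \<sigma>) = op_act P n (op_act P n x (transpose (\<sigma> 1) (\<sigma> 2))) \<sigma>"
    unfolding swap_def by (rule conjugate_transpose[OF assms(1,3) 12])
  also have "op_act P n x (transpose (\<sigma> 1) (\<sigma> 2)) = swap n x"
    unfolding swap_def using 12 permutes_in_image[OF assms(3)] inj_eq[OF permutes_inj[OF assms(3)]]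
    by (intro act_transpose[OF assms(1)]) (auto simp del: One_nat_def)
  finally show ?thesis by simp
qed

lemma comp_swap_right:
  assumes "x \<in> op_space P m" "y \<in> op_space P n" "i \<in> {1..m}" "n \<ge> 2"
  shows "op_comp P m n i x (swap n y) = swap (m + n - 1) (op_comp P m n i x y)"
proof -
  have "op_comp P m n i x (swap n y) =
    op_act P (m + n - 1) (op_comp P m n i x y) (transpose (i - 1 + 1) (i - 1 + 2))"
    unfolding swap_def by (rule comp_act_transpose_right[OF assms(1-3)]) (use assms in auto)
  also have "\<dots> = swap (m + n - 1) (op_comp P m n i x y)"
    unfolding swap_def by (rule act_transpose[OF comp_closed[OF assms(1-3)]]) (use assms in auto)
  finally show ?thesis .
qed

text \<open>
  The bound \<open>m \<ge> 3\<close> provides two inputs of \<open>x\<close> other than \<open>i\<close>.  Exchanging these does not touch the block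
  of \<open>y\<close>, so the exchange remains a transposition in the composite.
\<close>

lemma comp_swap_left:
  assumes "x \<in> op_space P m" "y \<in> op_space P n" "i \<in> {1..m}" "m \<ge> 3" "n \<ge> 1"
  shows "op_comp P m n i (swap m x) y = swap (m + n - 1) (op_comp P m n i x y)"
proof -
  define a :: nat where "a = (if i = 1 then 2 else 1)"
  define b :: nat where "b = (if i = 3 then 2 else 3)"
  have ab: "a \<in> {1..m}" "b \<in> {1..m}" "a \<noteq> i" "b \<noteq> i" "a \<noteq> b" using assms by (auto simp: a_def b_def)
  define a' where "a' = (if a < i then a else a + n - 1)"
  define b' where "b' = (if b < i then b else b + n - 1)"
  have ab': "a' \<in> {1..m + n - 1}" "b' \<in> {1..m + n - 1}" "a' \<noteq> b'"
    using ab assms by (auto simp: a'_def b'_def)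
  have "swap m x = op_act P m x (transpose a b)"
    unfolding swap_def by (rule act_transpose[OF assms(1) ab(1,2,5), symmetric])
  then have "op_comp P m n i (swap m x) y =
    op_act P (m + n - 1) (op_comp P m n (transpose a b i) x y) (perm_pcomp m n i (transpose a b) id)"
    using comp_act_left[OF assms(1-3) permutes_swap_id[OF ab(1,2)]] by simp
  also have "\<dots> = op_act P (m + n - 1) (op_comp P m n i x y) (transpose a' b')"
    using perm_pcomp_transpose_id[OF assms(3) ab(1-4) assms(5)] ab by (simp add: a'_def b'_def)
  also have "\<dots> = swap (m + n - 1) (op_comp P m n i x y)"
    unfolding swap_def by (rule act_transpose[OF comp_closed[OF assms(1-3)] ab'])
  finally show ?thesis .
qed

text \<open>
  The operator \<open>s - c\<close>, whose kernel is the eigenspace of \<open>s\<close> for the eigenvalue \<open>c\<close>.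
\<close>

definition eigen_defect :: "'k \<Rightarrow> nat \<Rightarrow> 'v \<Rightarrow> 'v" where
  "eigen_defect c n x = swap n x - op_scale P c x"

lemma eigen_defect_closed: "x \<in> op_space P n \<Longrightarrow> n \<ge> 2 \<Longrightarrow> eigen_defect c n x \<in> op_space P n"
  by (simp add: eigen_defect_def space_diff space_scale swap_closed)

lemma comp_eigen_defect_right:
  assumes "x \<in> op_space P m" "y \<in> op_space P n" "i \<in> {1..m}" "n \<ge> 2"
  shows "op_comp P m n i x (eigen_defect c n y) = eigen_defect c (m + n - 1) (op_comp P m n i x y)"
  using assms by (simp add: eigen_defect_def comp_diff_right swap_closed space_scale comp_swap_right
      comp_scale_right del: One_nat_def)

lemma comp_eigen_defect_left:
  assumes "x \<in> op_space P m" "y \<in> op_space P n" "i \<in> {1..m}" "m \<ge> 3" "n \<ge> 1"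
  shows "op_comp P m n i (eigen_defect c m x) y = eigen_defect c (m + n - 1) (op_comp P m n i x y)"
  using assms by (simp add: eigen_defect_def comp_diff_left swap_closed space_scale comp_swap_left
      comp_scale_left del: One_nat_def)

lemma eigen_defect_eigen_defect:
  assumes "x \<in> op_space P n" "n \<ge> 2"
  shows "eigen_defect 1 n (eigen_defect (- 1) n x) = 0"
proof -
  have perm: "transpose 1 2 permutes {1..n}" using transpose_1_2_permutes assms by blast
  have "swap n (swap n x - op_scale P (- 1) x) = swap n (swap n x) - op_scale P (- 1) (swap n x)"
    unfolding swap_def using assms perm act_diff act_scale act_closed space_scale by metis
  then show ?thesis using swap_swap[OF assms] by (simp add: eigen_defect_def)
qed

lemma operad_ideal_eigen_defect:
  "operad_ideal P (\<lambda>n. if n \<ge> 3 then eigen_defect c n ` op_space P n else {0})" (is "operad_ideal P ?I")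
proof -
  have "S_submodule P ?I"
    unfolding S_submodule_def
  proof (intro conjI allI impI)
    show "?I \<le> op_space P" by (auto simp: le_fun_def eigen_defect_closed space_zero)
    show "subspace (?I n)" for n
    proof (cases "n \<ge> 3")
      case True
      then have perm: "transpose 1 2 permutes {1..n}" using transpose_1_2_permutes by simp
      have "subspace (eigen_defect c n ` op_space P n)"
      proof (rule subspaceI)
        have "eigen_defect c n 0 = 0" using act_zero[OF perm] by (simp add: eigen_defect_def swap_def)
        then show "0 \<in> eigen_defect c n ` op_space P n" using space_zero[of n] by force
      next
        fix u w assume "u \<in> eigen_defect c n ` op_space P n" "w \<in> eigen_defect c n ` op_space P n"
        then obtain x y where "x \<in> op_space P n" "y \<in> op_space P n" "u = eigen_defect c n x" "w = eigen_defect c n y" by auto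
        then have "x + y \<in> op_space P n" "u + w = eigen_defect c n (x + y)"
          using act_add[OF _ _ perm] by (auto simp: eigen_defect_def swap_def scale_right_distrib space_add)
        then show "u + w \<in> eigen_defect c n ` op_space P n" by blast
      next
        fix r u assume "u \<in> eigen_defect c n ` op_space P n"
        then obtain x where "x \<in> op_space P n" "u = eigen_defect c n x" by auto
        then have "op_scale P r x \<in> op_space P n" "op_scale P r u = eigen_defect c n (op_scale P r x)"
          using act_scale[OF _ perm] by (auto simp: eigen_defect_def swap_def scale_right_diff_distrib
              space_scale mult.commute)
        then show "op_scale P r u \<in> eigen_defect c n ` op_space P n" by blast
      qed
      then show ?thesis using True by simp
    qed auto
    show "op_act P n x \<sigma> \<in> ?I n" if x: "x \<in> ?I n" and \<sigma>: "\<sigma> permutes {1..n}" for n x \<sigma>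
    proof (cases "n \<ge> 3")
      case True
      then obtain u where u: "u \<in> op_space P n" "x = eigen_defect c n u" using x by auto
      have "op_act P n x \<sigma> = eigen_defect c n (op_act P n u \<sigma>)"
        using u True \<sigma> by (simp add: eigen_defect_def act_diff swap_closed space_scale act_scale swap_act)
      then show ?thesis using True act_closed[OF u(1) \<sigma>] by auto
    qed (use x \<sigma> act_zero in auto)
  qed
  moreover have "op_comp P m n i x y \<in> ?I (m + n - 1)"
    if "x \<in> op_space P m" "y \<in> op_space P n" "i \<in> {1..m}" "x \<in> ?I m \<or> y \<in> ?I n" for m n i x y
  proof (cases "x = 0 \<or> y = 0")
    case True
    then have "op_comp P m n i x y = 0" using that comp_zero_left comp_zero_right by auto
    moreover have "0 \<in> ?I (m + n - 1)" using subspace_0 \<open>S_submodule P ?I\<close> unfolding S_submodule_def by blast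
    ultimately show ?thesis by simp
  next
    case False
    then have mn: "m \<ge> 1" "n \<ge> 1" using that arity_pos by auto
    from that(4) show ?thesis
    proof
      assume "x \<in> ?I m"
      then obtain u where u: "m \<ge> 3" "u \<in> op_space P m" "x = eigen_defect c m u" using False by (auto split: if_splits)
      then have "op_comp P m n i x y = eigen_defect c (m + n - 1) (op_comp P m n i u y)"
        using comp_eigen_defect_left that mn by blast
      then show ?thesis using u mn comp_closed[OF u(2) that(2,3)] by auto
    next
      assume "y \<in> ?I n"
      then obtain u where u: "n \<ge> 3" "u \<in> op_space P n" "y = eigen_defect c n u" using False by (auto split: if_splits)
      then have "op_comp P m n i x y = eigen_defect c (m + n - 1) (op_comp P m n i x u)"
        using comp_eigen_defect_right[OF that(1) u(2) that(3)] by simp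
      then show ?thesis using u mn comp_closed[OF that(1) u(2) that(3)] by auto
    qed
  qed
  ultimately show ?thesis unfolding operad_ideal_def by blast
qed

text \<open>
  The ideals \<open>(s - 1) P\<close> and \<open>(s + 1) P\<close> in arities at least 3 have product zero, as
  \<open>(s - 1) x \<circ>\<^sub>i (s + 1) y = (s\<^sup>2 - 1) (x \<circ>\<^sub>i y)\<close>.  No diagonalisation of \<open>s\<close> is involved, so
  characteristic 2 is covered.  Arity 2 follows by composing into arities where the claim is known.
\<close>

lemma swap_is_scalar:
  shows "\<exists>\<kappa>. (\<kappa> = 1 \<or> \<kappa> = -1) \<and> (\<forall>n x. n \<ge> 2 \<longrightarrow> x \<in> op_space P n \<longrightarrow> swap n x = op_scale P \<kappa> x)"
proof -
  define I where "I c n = (if n \<ge> 3 then eigen_defect c n ` op_space P n else {0})" for c and n :: nat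
  have "(\<forall>n. \<forall>x\<in>I 1 n. x = 0) \<or> (\<forall>n. \<forall>x\<in>I (-1) n. x = 0)"
  proof (rule prime_ideals[OF prime])
    show "operad_ideal P (I 1)" "operad_ideal P (I (-1))"
      unfolding I_def by (rule operad_ideal_eigen_defect)+
    fix m n i x y assume xy: "x \<in> I 1 m" "y \<in> I (-1) n" "i \<in> {1..m}"
    show "op_comp P m n i x y = 0"
    proof (cases "m \<ge> 3 \<and> n \<ge> 3")
      case True
      then obtain u w where u: "u \<in> op_space P m" "x = eigen_defect 1 m u"
        and w: "w \<in> op_space P n" "y = eigen_defect (-1) n w" using xy by (auto simp: I_def)
      have y: "y \<in> op_space P n" using w True eigen_defect_closed by simp
      have arity: "m + n - 1 \<ge> 2" using True by linarith
      have "op_comp P m n i x y = eigen_defect 1 (m + n - 1) (op_comp P m n i u y)"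
        unfolding u(2) using comp_eigen_defect_left u y xy True by simp
      also have "op_comp P m n i u y = eigen_defect (-1) (m + n - 1) (op_comp P m n i u w)"
        unfolding w(2) using comp_eigen_defect_right[OF u(1) w(1) xy(3)] True by simp
      also have "eigen_defect 1 (m + n - 1) \<dots> = 0"
        using eigen_defect_eigen_defect[OF comp_closed[OF u(1) w(1) xy(3)] arity] .
      finally show ?thesis .
    next
      case False
      moreover have "x \<in> op_space P m" "y \<in> op_space P n"
        using xy by (auto simp: I_def space_zero eigen_defect_closed split: if_splits)
      moreover have "x = 0 \<or> y = 0" using False xy by (auto simp: I_def split: if_splits)
      ultimately show ?thesis using xy comp_zero_left comp_zero_right by blast
    qed
  qed
  then obtain \<kappa> where \<kappa>: "\<kappa> = 1 \<or> \<kappa> = -1" "\<And>n x. x \<in> I \<kappa> n \<Longrightarrow> x = 0" by blast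
  have large: "eigen_defect \<kappa> n x = 0" if "n \<ge> 3" "x \<in> op_space P n" for n x
    using \<kappa>(2)[of "eigen_defect \<kappa> n x" n] that by (simp add: I_def)
  have "swap n x = op_scale P \<kappa> x" if "n \<ge> 2" "x \<in> op_space P n" for n x
  proof -
    have "eigen_defect \<kappa> n x = 0"
    proof (rule large_arity_faithful[of _ n 2])
      show "eigen_defect \<kappa> n x \<in> op_space P n" using eigen_defect_closed that by blast
      show "op_comp P m n i y (eigen_defect \<kappa> n x) = 0" if "m \<ge> 2" "y \<in> op_space P m" "i \<in> {1..m}" for m y i
        using comp_eigen_defect_right[OF that(2) \<open>x \<in> _\<close> that(3) \<open>n \<ge> 2\<close>, of \<kappa>]
          large[of "m + n - 1"] comp_closed[OF that(2) \<open>x \<in> _\<close> that(3)] that(1) \<open>n \<ge> 2\<close> by simp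
    qed
    then show ?thesis by (simp add: eigen_defect_def)
  qed
  then show ?thesis using \<kappa>(1) by blast
qed

end

section \<open>Graded commutative domains\<close>

text \<open>
  The number \<open>g\<close> is the least positive difference of two elements of \<open>S\<close>: the remainder of an element
  modulo \<open>g\<close> is again such a difference, hence zero.  For \<open>S = {0}\<close> the witnesses are \<open>a = b = 0\<close> and
  \<open>g = 1\<close>.
\<close>

lemma submonoid_nat_difference:
  fixes S :: "nat set"
  assumes S0: "0 \<in> S" and S_add: "\<And>p q. p \<in> S \<Longrightarrow> q \<in> S \<Longrightarrow> p + q \<in> S"
  shows "\<exists>a\<in>S. \<exists>b\<in>S. \<exists>g>0. \<forall>p\<in>S. g dvd p \<and> p + p div g * b = p div g * a"
proof (cases "S \<subseteq> {0}")
  case True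
  then show ?thesis using S0 by (intro bexI[of _ 0] exI[of _ 1]) auto
next
  case False
  have S_mult: "q * p \<in> S" if "p \<in> S" for p q by (induction q) (use that S0 S_add in auto)
  define D where "D d \<longleftrightarrow> d > 0 \<and> (\<exists>a\<in>S. \<exists>b\<in>S. a = b + d)" for d
  obtain s where "s \<in> S" "s \<noteq> 0" using False by blast
  then have "D s" using S0 by (auto simp: D_def)
  define g where "g = (LEAST d. D d)"
  have "D g" unfolding g_def using \<open>D s\<close> by (rule LeastI)
  then obtain a b where g: "g > 0" "a \<in> S" "b \<in> S" "a = b + g" by (auto simp: D_def)
  have "g dvd p \<and> p + p div g * b = p div g * a" if p: "p \<in> S" for p
  proof -
    have eq: "p + p div g * b = p div g * a + p mod g"
      using div_mult_mod_eq[of p g] by (simp add: g(4) algebra_simps)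
    have "\<not> D (p mod g)" unfolding g_def using g(1) not_less_Least[of "p mod g" D]
      by (simp add: g_def)
    moreover have "p + p div g * b \<in> S" "p div g * a \<in> S" using S_add S_mult p g by auto
    ultimately have "p mod g = 0" using eq unfolding D_def by (metis gr0I)
    then show ?thesis using eq by (simp add: dvd_eq_mod_eq_0)
  qed
  then show ?thesis using g by blast
qed

text \<open>
  The homogeneous components \<open>A p\<close> are subspaces of one ambient space that need not be independent, so
  the product carries the degrees of its factors.
\<close>

locale graded_commutative_domain = vector_space scale
  for scale :: "'k::field \<Rightarrow> 'v::ab_group_add \<Rightarrow> 'v" (infixr \<open>\<cdot>\<close> 75) +
  fixes A :: "nat \<Rightarrow> 'v set" and mul :: "nat \<Rightarrow> nat \<Rightarrow> 'v \<Rightarrow> 'v \<Rightarrow> 'v" and one :: 'v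
  assumes A_subspace: "subspace (A p)"
    and mul_closed: "x \<in> A p \<Longrightarrow> y \<in> A q \<Longrightarrow> mul p q x y \<in> A (p + q)"
    and mul_add_left: "x \<in> A p \<Longrightarrow> x' \<in> A p \<Longrightarrow> y \<in> A q \<Longrightarrow>
      mul p q (x + x') y = mul p q x y + mul p q x' y"
    and mul_scale_left: "x \<in> A p \<Longrightarrow> y \<in> A q \<Longrightarrow> mul p q (c \<cdot> x) y = c \<cdot> mul p q x y"
    and mul_commute: "x \<in> A p \<Longrightarrow> y \<in> A q \<Longrightarrow> mul p q x y = mul q p y x"
    and mul_assoc: "x \<in> A p \<Longrightarrow> y \<in> A q \<Longrightarrow> z \<in> A r \<Longrightarrow>
      mul (p + q) r (mul p q x y) z = mul p (q + r) x (mul q r y z)"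
    and one_closed: "one \<in> A 0"
    and one_mul: "x \<in> A p \<Longrightarrow> mul 0 p one x = x"
    and one_nonzero: "one \<noteq> 0"
    and no_zero_divisors: "x \<in> A p \<Longrightarrow> y \<in> A q \<Longrightarrow> mul p q x y = 0 \<Longrightarrow> x = 0 \<or> y = 0"
begin

lemma A_zero: "0 \<in> A p"
  and A_add: "x \<in> A p \<Longrightarrow> y \<in> A p \<Longrightarrow> x + y \<in> A p"
  and A_diff: "x \<in> A p \<Longrightarrow> y \<in> A p \<Longrightarrow> x - y \<in> A p"
  and A_scale: "x \<in> A p \<Longrightarrow> c \<cdot> x \<in> A p"
  and A_sum: "(\<And>i. i \<in> I \<Longrightarrow> g i \<in> A p) \<Longrightarrow> sum g I \<in> A p"
  using A_subspace[of p] by (auto intro: subspace_0 subspace_add subspace_diff subspace_scale subspace_sum)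

lemma mul_add_right: "x \<in> A p \<Longrightarrow> y \<in> A q \<Longrightarrow> y' \<in> A q \<Longrightarrow>
    mul p q x (y + y') = mul p q x y + mul p q x y'"
  using mul_add_left[of y q y' x p] by (simp add: mul_commute[of x p] A_add)

lemma mul_scale_right: "x \<in> A p \<Longrightarrow> y \<in> A q \<Longrightarrow> mul p q x (c \<cdot> y) = c \<cdot> mul p q x y"
  using mul_scale_left[of y q x p c] by (simp add: mul_commute[of x p] A_scale)

lemma mul_zero_right: "x \<in> A p \<Longrightarrow> mul p q x 0 = 0"
  using mul_scale_right[OF _ A_zero, of x p q 0] by simp

lemma mul_zero_left: "y \<in> A q \<Longrightarrow> mul p q 0 y = 0"
  using mul_scale_left[OF A_zero, of y q p 0] by simp

lemma mul_diff_left: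
  "x \<in> A p \<Longrightarrow> x' \<in> A p \<Longrightarrow> y \<in> A q \<Longrightarrow> mul p q (x - x') y = mul p q x y - mul p q x' y"
  using mul_add_left[of "x - x'" p x' y q] by (simp add: A_diff algebra_simps)

lemma mul_sum_right:
  "x \<in> A p \<Longrightarrow> (\<And>i. i \<in> I \<Longrightarrow> g i \<in> A q) \<Longrightarrow> mul p q x (sum g I) = (\<Sum>i\<in>I. mul p q x (g i))"
  by (induction I rule: infinite_finite_induct) (auto simp: mul_zero_right mul_add_right A_sum)

lemma mul_left_commute:
  assumes "x \<in> A p" "y \<in> A q" "z \<in> A r"
  shows "mul p (q + r) x (mul q r y z) = mul q (p + r) y (mul p r x z)"
  using assms mul_assoc[of x p y q z r] mul_assoc[of y q x p z r] mul_commute[of x p y q]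
  by (simp add: add.commute)

lemma mul_interchange:
  assumes "x \<in> A p" "y \<in> A q" "u \<in> A r" "v \<in> A s"
  shows "mul (p + q) (r + s) (mul p q x y) (mul r s u v) = mul (p + r) (q + s) (mul p r x u) (mul q s y v)"
proof -
  have "mul (p + q) (r + s) (mul p q x y) (mul r s u v) = mul p (q + (r + s)) x (mul q (r + s) y (mul r s u v))"
    using assms by (simp add: mul_assoc mul_closed)
  also have "mul q (r + s) y (mul r s u v) = mul r (q + s) u (mul q s y v)"
    using assms by (simp add: mul_left_commute)
  also have "mul p (q + (r + s)) x \<dots> = mul (p + r) (q + s) (mul p r x u) (mul q s y v)"
    using mul_assoc[OF assms(1,3) mul_closed[OF assms(2,4)]] by (simp add: add.left_commute)
  finally show ?thesis .
qed

primrec gpow :: "nat \<Rightarrow> 'v \<Rightarrow> nat \<Rightarrow> 'v" where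
  "gpow p x 0 = one"
| "gpow p x (Suc k) = mul p (k * p) x (gpow p x k)"

lemma gpow_closed: "x \<in> A p \<Longrightarrow> gpow p x k \<in> A (k * p)"
  by (induction k) (auto simp: one_closed mul_closed)

lemma gpow_nonzero: "x \<in> A p \<Longrightarrow> x \<noteq> 0 \<Longrightarrow> gpow p x k \<noteq> 0"
  by (induction k) (simp add: one_nonzero, metis gpow.simps(2) gpow_closed no_zero_divisors)

lemma gpow_add:
  assumes "x \<in> A p"
  shows "gpow p x (j + k) = mul (j * p) (k * p) (gpow p x j) (gpow p x k)"
proof (induction j)
  case (Suc j)
  then show ?case
    using assms mul_assoc[OF assms gpow_closed[OF assms] gpow_closed[OF assms], of j k]
    by (simp add: add_mult_distrib)
qed (simp add: one_mul gpow_closed assms)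

definition monomial :: "nat \<Rightarrow> 'v \<Rightarrow> 'v \<Rightarrow> nat \<Rightarrow> nat \<Rightarrow> 'v" where
  "monomial p x y i j = mul (i * p) (j * p) (gpow p x i) (gpow p y j)"

text \<open>
  The homogenization of the polynomial \<open>f\<close> to degree \<open>k\<close>, evaluated at \<open>(x, y)\<close>; coefficients of \<open>f\<close>
  beyond \<open>k\<close> are dropped.
\<close>

definition binary_form :: "nat \<Rightarrow> 'v \<Rightarrow> 'v \<Rightarrow> nat \<Rightarrow> 'k poly \<Rightarrow> 'v" where
  "binary_form p x y k f = (\<Sum>i\<le>k. coeff f i \<cdot> monomial p x y i (k - i))"

lemma monomial_closed:
  assumes "x \<in> A p" "y \<in> A p"
  shows "monomial p x y i j \<in> A ((i + j) * p)"
  using mul_closed[OF gpow_closed[OF assms(1)] gpow_closed[OF assms(2)]]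
  by (simp add: monomial_def add_mult_distrib)

lemma mul_monomial_first:
  assumes "x \<in> A p" "y \<in> A p"
  shows "mul p ((i + j) * p) x (monomial p x y i j) = monomial p x y (Suc i) j"
  using mul_assoc[OF assms(1) gpow_closed[OF assms(1)] gpow_closed[OF assms(2)], of i j]
  by (simp add: monomial_def add_mult_distrib)

lemma mul_monomial_second:
  assumes "x \<in> A p" "y \<in> A p"
  shows "mul p ((i + j) * p) y (monomial p x y i j) = monomial p x y i (Suc j)"
  using mul_left_commute[OF assms(2) gpow_closed[OF assms(1)] gpow_closed[OF assms(2)], of i j]
  by (simp add: monomial_def add_mult_distrib)

lemma binary_form_closed:
  assumes "x \<in> A p" "y \<in> A p"
  shows "binary_form p x y k f \<in> A (k * p)"
  unfolding binary_form_def using monomial_closed[OF assms]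
  by (intro A_sum A_scale) (metis atMost_iff le_add_diff_inverse)

lemma binary_form_pCons_0:
  assumes "x \<in> A p" "y \<in> A p"
  shows "binary_form p x y (Suc k) (pCons 0 f) = mul p (k * p) x (binary_form p x y k f)"
proof -
  have mon: "monomial p x y i (k - i) \<in> A (k * p)" if "i \<le> k" for i
    using monomial_closed[OF assms, of i "k - i"] that by simp
  have "binary_form p x y (Suc k) (pCons 0 f) = (\<Sum>i\<le>k. coeff f i \<cdot> monomial p x y (Suc i) (k - i))"
    unfolding binary_form_def by (subst sum.atMost_Suc_shift) simp
  also have "\<dots> = (\<Sum>i\<le>k. mul p (k * p) x (coeff f i \<cdot> monomial p x y i (k - i)))"
  proof (intro sum.cong refl)
    fix i assume "i \<in> {..k}"
    then show "coeff f i \<cdot> monomial p x y (Suc i) (k - i) = mul p (k * p) x (coeff f i \<cdot> monomial p x y i (k - i))"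
      using mul_monomial_first[OF assms, of i "k - i"] mon[of i] by (simp add: mul_scale_right assms)
  qed
  also have "\<dots> = mul p (k * p) x (binary_form p x y k f)"
    unfolding binary_form_def using mon by (intro mul_sum_right[symmetric] assms) (auto intro: A_scale)
  finally show ?thesis .
qed

lemma binary_form_raise_degree:
  assumes "x \<in> A p" "y \<in> A p" "degree f \<le> k"
  shows "binary_form p x y (Suc k) f = mul p (k * p) y (binary_form p x y k f)"
proof -
  have mon: "monomial p x y i (k - i) \<in> A (k * p)" if "i \<le> k" for i
    using monomial_closed[OF assms(1,2), of i "k - i"] that by simp
  have "binary_form p x y (Suc k) f = (\<Sum>i\<le>k. coeff f i \<cdot> monomial p x y i (Suc k - i))"
    using assms(3) by (simp add: binary_form_def coeff_eq_0)
  also have "\<dots> = (\<Sum>i\<le>k. mul p (k * p) y (coeff f i \<cdot> monomial p x y i (k - i)))"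
  proof (intro sum.cong refl)
    fix i assume "i \<in> {..k}"
    then show "coeff f i \<cdot> monomial p x y i (Suc k - i) = mul p (k * p) y (coeff f i \<cdot> monomial p x y i (k - i))"
      using mul_monomial_second[OF assms(1,2), of i "k - i"] mon[of i]
      by (simp add: mul_scale_right assms Suc_diff_le)
  qed
  also have "\<dots> = mul p (k * p) y (binary_form p x y k f)"
    unfolding binary_form_def using mon by (intro mul_sum_right[symmetric] assms) (auto intro: A_scale)
  finally show ?thesis .
qed

lemma binary_form_diff_smult:
  "binary_form p x y k (f - smult c g) = binary_form p x y k f - c \<cdot> binary_form p x y k g"
  by (simp add: binary_form_def scale_left_diff_distrib scale_sum_right sum_subtractf)

end

text \<open>
  Choose homogeneous \<open>u, v \<noteq> 0\<close> whose degrees \<open>a\<close> and \<open>b\<close> satisfy \<open>p + q b = q a\<close> for every degree \<open>p\<close> that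
  occurs and \<open>q = p div g\<close>.  For \<open>x\<close> of degree \<open>p\<close>, the elements \<open>x v\<^sup>q\<close> and \<open>u\<^sup>q\<close> then lie in the same
  line, and \<open>f x\<close> is their ratio.  The ratio is multiplicative, as \<open>q\<close> is additive in \<open>p\<close>, and vanishes only
  at zero, as there are no zero divisors.
\<close>

lemma (in graded_commutative_domain) embedding_of_one_dimensional:
  assumes line: "\<And>p x y. x \<in> A p \<Longrightarrow> y \<in> A p \<Longrightarrow> y \<noteq> 0 \<Longrightarrow> \<exists>c. x = c \<cdot> y"
  obtains f :: "nat \<Rightarrow> 'v \<Rightarrow> 'k" where
    "\<And>p x y. x \<in> A p \<Longrightarrow> y \<in> A p \<Longrightarrow> f p (x + y) = f p x + f p y"
    "\<And>p c x. x \<in> A p \<Longrightarrow> f p (c \<cdot> x) = c * f p x"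
    "\<And>p q x y. x \<in> A p \<Longrightarrow> y \<in> A q \<Longrightarrow> f (p + q) (mul p q x y) = f p x * f q y"
    "f 0 one = 1"
    "\<And>p x. x \<in> A p \<Longrightarrow> f p x = 0 \<longleftrightarrow> x = 0"
proof -
  define S where "S = {p. \<exists>x\<in>A p. x \<noteq> 0}"
  have S0: "0 \<in> S" using one_closed one_nonzero by (auto simp: S_def)
  have S_add: "p + q \<in> S" if "p \<in> S" "q \<in> S" for p q
    using that mul_closed no_zero_divisors unfolding S_def by blast
  obtain a b g where ab: "a \<in> S" "b \<in> S" and g: "\<And>p. p \<in> S \<Longrightarrow> g dvd p" "g > 0"
    and shift: "\<And>p. p \<in> S \<Longrightarrow> p + p div g * b = p div g * a"
    using submonoid_nat_difference[OF S0 S_add] by metis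
  obtain u v where u: "u \<in> A a" "u \<noteq> 0" and v: "v \<in> A b" "v \<noteq> 0" using ab by (auto simp: S_def)
  define \<phi> where "\<phi> p x c \<longleftrightarrow> mul p (p div g * b) x (gpow b v (p div g)) = c \<cdot> gpow a u (p div g)" for p x c
  have \<phi>_ex: "\<exists>c. \<phi> p x c" if "p \<in> S" "x \<in> A p" for p x
    unfolding \<phi>_def
    using line[OF _ gpow_closed[OF u(1)] gpow_nonzero[OF u]] mul_closed[OF that(2) gpow_closed[OF v(1)]]
      shift[OF that(1)] by metis
  have \<phi>_unique: "c = c'" if "\<phi> p x c" "\<phi> p x c'" for p x c c'
    using that gpow_nonzero[OF u] by (auto simp: \<phi>_def)
  define f where "f p x = (if x = 0 then 0 else SOME c. \<phi> p x c)" for p x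
  have S: "p \<in> S" if "x \<in> A p" "x \<noteq> 0" for p x using that by (auto simp: S_def)
  have \<phi>_zero: "\<phi> p 0 0" for p by (simp add: \<phi>_def mul_zero_left gpow_closed v)
  have \<phi>_f: "\<phi> p x (f p x)" if "x \<in> A p" for p x
    using \<phi>_ex[OF S[OF that] that] \<phi>_zero by (auto simp: f_def intro: someI_ex)
  have \<phi>_add: "\<phi> p (x + y) (c + c')" if "x \<in> A p" "y \<in> A p" "\<phi> p x c" "\<phi> p y c'" for p x y c c'
    using that by (simp add: \<phi>_def mul_add_left gpow_closed v scale_left_distrib)
  have \<phi>_scale: "\<phi> p (d \<cdot> x) (d * c)" if "x \<in> A p" "\<phi> p x c" for p x c d
    using that by (simp add: \<phi>_def mul_scale_left gpow_closed v)
  have \<phi>_mul: "\<phi> (p + q) (mul p q x y) (c * c')"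
    if "x \<in> A p" "y \<in> A q" "\<phi> p x c" "\<phi> q y c'" "p \<in> S" "q \<in> S" for p q x y c c'
  proof -
    let ?i = "p div g" and ?j = "q div g"
    have ij: "(p + q) div g = ?i + ?j" using g(1)[OF that(5)] by (simp add: div_plus_div_distrib_dvd_left)
    have "mul (p + q) (?i * b + ?j * b) (mul p q x y) (gpow b v (?i + ?j)) =
      mul (p + ?i * b) (q + ?j * b) (mul p (?i * b) x (gpow b v ?i)) (mul q (?j * b) y (gpow b v ?j))"
      unfolding gpow_add[OF v(1)] by (rule mul_interchange[OF that(1,2) gpow_closed[OF v(1)] gpow_closed[OF v(1)]])
    also have "\<dots> = mul (?i * a) (?j * a) (c \<cdot> gpow a u ?i) (c' \<cdot> gpow a u ?j)"
      using that shift unfolding \<phi>_def by simp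
    also have "\<dots> = (c * c') \<cdot> gpow a u (?i + ?j)"
      by (simp add: gpow_add u mul_scale_left mul_scale_right gpow_closed A_scale)
    finally show ?thesis by (simp add: \<phi>_def ij add_mult_distrib)
  qed
  show ?thesis
  proof (rule that[of f])
    show "f p (x + y) = f p x + f p y" if "x \<in> A p" "y \<in> A p" for p x y
      using \<phi>_unique[OF \<phi>_f[OF A_add[OF that]] \<phi>_add[OF that \<phi>_f[OF that(1)] \<phi>_f[OF that(2)]]] .
    show "f p (c \<cdot> x) = c * f p x" if "x \<in> A p" for p c x
      using \<phi>_unique[OF \<phi>_f[OF A_scale[OF that]] \<phi>_scale[OF that \<phi>_f[OF that]]] .
    show "f (p + q) (mul p q x y) = f p x * f q y" if "x \<in> A p" "y \<in> A q" for p q x y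
    proof (cases "x = 0 \<or> y = 0")
      case True
      then show ?thesis using that by (auto simp: f_def mul_zero_left mul_zero_right)
    next
      case False
      then show ?thesis
        using \<phi>_unique[OF \<phi>_f[OF mul_closed[OF that]] \<phi>_mul[OF that \<phi>_f[OF that(1)] \<phi>_f[OF that(2)]]] S that
        by blast
    qed
    have "\<phi> 0 one 1" by (simp add: \<phi>_def one_mul one_closed)
    then show "f 0 one = 1" using \<phi>_unique \<phi>_f[OF one_closed] by blast
    show "f p x = 0 \<longleftrightarrow> x = 0" if "x \<in> A p" for p x
    proof
      assume "f p x = 0"
      then have "mul p (p div g * b) x (gpow b v (p div g)) = 0" using \<phi>_f[OF that] by (simp add: \<phi>_def)
      then show "x = 0" using no_zero_divisors[OF that gpow_closed[OF v(1)]] gpow_nonzero[OF v] by blast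
    qed (simp add: f_def)
  qed
qed

locale graded_commutative_domain_alg_closed = graded_commutative_domain scale A mul one
  for scale :: "'k::alg_closed_field \<Rightarrow> 'v::ab_group_add \<Rightarrow> 'v" (infixr \<open>\<cdot>\<close> 75) and A mul one
begin

text \<open>
  A root \<open>r\<close> of \<open>f\<close> splits off the linear factor \<open>x - r y\<close>, and if the degree of \<open>f\<close> is smaller than \<open>k\<close>, the
  factor \<open>y\<close>.  One of the factors must vanish.
\<close>

lemma binary_form_zero_imp_proportional:
  assumes x: "x \<in> A p" and y: "y \<in> A p" "y \<noteq> 0"
    and f: "f \<noteq> 0" "degree f \<le> k" "binary_form p x y k f = 0"
  shows "\<exists>c. x = c \<cdot> y"
  using f
proof (induction k arbitrary: f)
  case 0
  then have "coeff f 0 \<noteq> 0" by (metis leading_coeff_0_iff le_zero_eq)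
  moreover have "binary_form p x y 0 f = coeff f 0 \<cdot> one"
    by (simp add: binary_form_def monomial_def one_mul one_closed)
  ultimately show ?case using 0 one_nonzero by simp
next
  case (Suc k)
  show ?case
  proof (cases "degree f \<le> k")
    case True
    then have "mul p (k * p) y (binary_form p x y k f) = 0"
      using binary_form_raise_degree[OF x y(1) True] Suc.prems by simp
    then have "binary_form p x y k f = 0"
      using no_zero_divisors[OF y(1) binary_form_closed[OF x y(1)]] y(2) by blast
    then show ?thesis using Suc.IH Suc.prems(1) True by blast
  next
    case False
    then have deg: "degree f = Suc k" using Suc.prems by simp
    then obtain r where "poly f r = 0" using alg_closed_imp_poly_has_root[of f] by auto
    then obtain h where h: "f = [:- r, 1:] * h" using poly_eq_0_iff_dvd by (metis dvd_def)
    have h0: "h \<noteq> 0" using Suc.prems(1) h by auto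
    have degh: "degree h = k" using deg h h0 by (simp add: degree_mult_eq del: mult_pCons_left)
    have "f = pCons 0 h - smult r h" unfolding h by simp
    then have "0 = mul p (k * p) x (binary_form p x y k h) - r \<cdot> mul p (k * p) y (binary_form p x y k h)"
      using Suc.prems(3) binary_form_diff_smult binary_form_pCons_0[OF x y(1)]
        binary_form_raise_degree[OF x y(1)] degh by simp
    also have "\<dots> = mul p (k * p) (x - r \<cdot> y) (binary_form p x y k h)"
      using x y by (simp add: mul_diff_left mul_scale_left A_scale binary_form_closed)
    finally have "x - r \<cdot> y = 0 \<or> binary_form p x y k h = 0"
      using no_zero_divisors[OF A_diff[OF x A_scale[OF y(1)]] binary_form_closed[OF x y(1)]] by metis
    then show ?thesis
    proof
      assume "x - r \<cdot> y = 0"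
      then have "x = r \<cdot> y" by simp
      then show ?thesis ..
    next
      assume "binary_form p x y k h = 0"
      then show ?thesis using Suc.IH[OF h0] degh by simp
    qed
  qed
qed

text \<open>
  If \<open>x\<close> and \<open>y\<close> were not proportional, the \<open>k + 1\<close> monomials of degree \<open>k\<close> in \<open>x\<close> and \<open>y\<close> would be linearly
  independent.
\<close>

lemma small_dimension_imp_proportional:
  assumes x: "x \<in> A p" and y: "y \<in> A p" "y \<noteq> 0"
    and B: "finite B" "A (k * p) \<subseteq> span B" "card B \<le> k"
  shows "\<exists>c. x = c \<cdot> y"
proof -
  have "card {()} * card B < card {..k}" using B(3) by simp
  moreover have "monomial p x y i (k - i) \<in> span B" if "i \<in> {..k}" for i
    using that monomial_closed[OF x y(1), of i "k - i"] B(2) by auto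
  ultimately obtain a where a: "\<exists>i\<in>{..k}. a i \<noteq> 0" "(\<Sum>i\<le>k. a i \<cdot> monomial p x y i (k - i)) = 0"
    using simultaneous_linear_relation[OF B(1), of "{()}" "{..k}" "\<lambda>_ i. monomial p x y i (k - i)"] by auto
  define f where "f = Poly (map a [0..<Suc k])"
  have coeff_f: "coeff f i = (if i \<le> k then a i else 0)" for i
    by (auto simp: f_def nth_default_def simp del: upt_Suc)
  show ?thesis
  proof (rule binary_form_zero_imp_proportional[OF x y])
    show "f \<noteq> 0" using a(1) coeff_f by (metis atMost_iff coeff_0)
    show "degree f \<le> k" by (rule degree_le) (simp add: coeff_f)
    show "binary_form p x y k f = 0" using a(2) by (simp add: binary_form_def coeff_f)
  qed
qed

end

section \<open>Operads on which permutations act by a character\<close>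

locale sign_operad = unbounded_prime_operad P for P :: "('k::field, 'v::ab_group_add) operad_data" +
  fixes \<kappa> :: 'k
  assumes kappa: "\<kappa> = 1 \<or> \<kappa> = -1"
    and act_transpose: "x \<in> op_space P n \<Longrightarrow> a \<in> {1..n} \<Longrightarrow> b \<in> {1..n} \<Longrightarrow> a \<noteq> b \<Longrightarrow>
      op_act P n x (transpose a b) = op_scale P \<kappa> x"
begin

lemma kappa_power_square: "\<kappa> ^ j * \<kappa> ^ j = 1"
  using kappa by (auto simp flip: power_mult_distrib)

lemma act_by_sign:
  assumes x: "x \<in> op_space P n" and \<sigma>: "\<sigma> permutes {1..n}"
  shows "op_act P n x \<sigma> = op_scale P (if evenperm \<sigma> then 1 else \<kappa>) x"
  using \<sigma> finite_atLeastAtMost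
proof (induction \<sigma> rule: permutes_induct)
  case id
  then show ?case using act_id[OF x] evenperm_id by (simp add: id_def)
next
  case (swap a b p)
  have t: "transpose a b permutes {1..n}" using swap by (intro permutes_swap_id)
  have perms: "permutation p" "permutation (transpose a b)"
    using swap(4) permutation_permutes[of p] permutation_swap_id by auto
  have "op_act P n x (transpose a b \<circ> p) = op_act P n (op_scale P \<kappa> x) p"
    using act_act[OF x t swap(4)] act_transpose[OF x swap(1-3)] by simp
  also have "\<dots> = op_scale P \<kappa> (op_scale P (if evenperm p then 1 else \<kappa>) x)"
    using act_scale[OF x swap(4)] swap(5) by simp
  also have "\<dots> = op_scale P (if evenperm (transpose a b \<circ> p) then 1 else \<kappa>) x"
    using evenperm_comp[OF perms(2,1)] evenperm_swap[of a b] swap(3) kappa_power_square[of 1] by simp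
  finally show ?case .
qed

lemma act_block_cycle:
  assumes x: "x \<in> op_space P N" and i: "1 \<le> i" and n: "i + n \<le> N"
  shows "op_act P N x (block_cycle i n) = op_scale P (\<kappa> ^ n) x"
  using n
proof (induction n)
  case 0
  then show ?case using act_id[OF x] by (simp add: id_def)
next
  case (Suc n)
  have mem: "i + n \<in> {1..N}" "i + n + 1 \<in> {1..N}" using Suc.prems i by auto
  have c: "block_cycle i n permutes {1..N}" using permutes_block_cycle i Suc.prems by simp
  have "op_act P N x (block_cycle i (Suc n)) =
    op_act P N (op_act P N x (block_cycle i n)) (transpose (i + n) (i + n + 1))"
    using act_act[OF x c permutes_swap_id[OF mem]] by simp
  also have "\<dots> = op_scale P \<kappa> (op_act P N x (block_cycle i n))"
    using act_transpose[OF act_closed[OF x c] mem] by simp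
  also have "\<dots> = op_scale P (\<kappa> ^ Suc n) x" using Suc by simp
  finally show ?case .
qed

text \<open>
  Exchanging inputs \<open>i\<close> and \<open>i + 1\<close> of \<open>x\<close> costs one factor \<open>\<kappa>\<close> before the composition and \<open>n\<close> factors after it,
  since input \<open>i + 1\<close> then moves past the whole block of \<open>y\<close>.
\<close>

lemma comp_next_input:
  assumes x: "x \<in> op_space P m" and y: "y \<in> op_space P n" and i: "1 \<le> i" "i < m" and n: "n \<ge> 1"
  shows "op_comp P m n (i + 1) x y = op_scale P (\<kappa> ^ (n + 1)) (op_comp P m n i x y)"
proof -
  have mem: "i \<in> {1..m}" "i + 1 \<in> {1..m}" using i by auto
  have "op_scale P \<kappa> (op_comp P m n i x y) = op_comp P m n i (op_act P m x (transpose i (i + 1))) y"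
    using act_transpose[OF x mem] comp_scale_left[OF x y mem(1)] by simp
  also have "\<dots> = op_act P (m + n - 1) (op_comp P m n (i + 1) x y) (block_cycle i n)"
    using comp_act_left[OF x y mem(1) permutes_swap_id[OF mem]]
      perm_pcomp_adjacent_transpose[OF i n] by simp
  also have "\<dots> = op_scale P (\<kappa> ^ n) (op_comp P m n (i + 1) x y)"
    by (rule act_block_cycle[OF comp_closed[OF x y mem(2)]]) (use i in auto)
  finally have "op_scale P (\<kappa> ^ n) (op_scale P \<kappa> (op_comp P m n i x y)) =
    op_scale P (\<kappa> ^ n * \<kappa> ^ n) (op_comp P m n (i + 1) x y)" by simp
  then show ?thesis by (simp add: kappa_power_square mult.commute)
qed

lemma comp_input:
  assumes x: "x \<in> op_space P m" and y: "y \<in> op_space P n" and i: "i \<in> {1..m}" and n: "n \<ge> 1"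
  shows "op_comp P m n i x y = op_scale P (\<kappa> ^ ((n + 1) * (i - 1))) (op_comp P m n 1 x y)"
proof -
  have "1 \<le> i" "i \<le> m" using i by auto
  then show ?thesis
  proof (induction i rule: dec_induct)
    case base
    then show ?case by simp
  next
    case (step j)
    have "op_comp P m n (Suc j) x y = op_scale P (\<kappa> ^ (n + 1)) (op_comp P m n j x y)"
      using comp_next_input[OF x y step(1) _ n] step by simp
    also have "\<dots> = op_scale P (\<kappa> ^ (n + 1) * \<kappa> ^ ((n + 1) * (j - 1))) (op_comp P m n 1 x y)"
      using step by simp
    also have "\<kappa> ^ (n + 1) * \<kappa> ^ ((n + 1) * (j - 1)) = \<kappa> ^ ((n + 1) * (Suc j - 1))"
      using step(1) by (cases j) (auto simp: power_add)
    finally show ?case .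
  qed
qed

lemma comp_first_zero_imp_comp_zero:
  assumes "x \<in> op_space P m" "y \<in> op_space P n" "i \<in> {1..m}" "op_comp P m n 1 x y = 0"
  shows "op_comp P m n i x y = 0"
proof (cases "n = 0")
  case True
  then have "y = 0" using arity_pos assms by fastforce
  then show ?thesis using comp_zero_right assms by blast
next
  case False
  then show ?thesis using comp_input[OF assms(1-3)] assms(4) by simp
qed

text \<open>
  By the parallel axiom \<open>(x \<circ>\<^sub>1 y) \<circ>\<^sub>n\<^sub>+\<^sub>1 z = (x \<circ>\<^sub>2 z) \<circ>\<^sub>1 y\<close>.  Moving all compositions to the first input
  shows that \<open>x \<circ>\<^sub>1 (y \<circ>\<^sub>1 z)\<close> and \<open>x \<circ>\<^sub>1 (z \<circ>\<^sub>1 y)\<close> agree up to the sign.  As \<open>x\<close> is an arbitrary element of arity at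
  least 2, it can be cancelled.  The degrees that govern the sign are \<open>n - 1\<close> and \<open>l - 1\<close>, which have
  the parity of \<open>n + 1\<close> and \<open>l + 1\<close>.
\<close>

lemma comp_supercommute:
  assumes y: "y \<in> op_space P n" and z: "z \<in> op_space P l" and n: "n \<ge> 1" and l: "l \<ge> 1"
  shows "op_comp P n l 1 y z = op_scale P (\<kappa> ^ ((n + 1) * (l + 1))) (op_comp P l n 1 z y)"
proof -
  let ?c = "\<kappa> ^ ((n + 1) * (l + 1))"
  have one_n: "1 \<in> {1..n}" and one_l: "1 \<in> {1..l}" using n l by auto
  have yz: "op_comp P n l 1 y z \<in> op_space P (n + l - 1)" using comp_closed[OF y z one_n] .
  have zy: "op_comp P l n 1 z y \<in> op_space P (n + l - 1)" using comp_closed[OF z y one_l] by (simp add: add.commute)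
  have "op_comp P n l 1 y z - op_scale P ?c (op_comp P l n 1 z y) = 0" (is "?w = 0")
  proof (rule large_arity_faithful[of _ "n + l - 1" 2])
    show w: "?w \<in> op_space P (n + l - 1)" using yz zy space_diff space_scale by blast
    fix m x i assume m: "m \<ge> 2" and x: "x \<in> op_space P m" and i: "i \<in> {1..m}"
    have one_m: "1 \<in> {1..m}" and two_m: "2 \<in> {1..m}" using m by auto
    have xy: "op_comp P m n 1 x y \<in> op_space P (m + n - 1)" and xz: "op_comp P m l 1 x z \<in> op_space P (m + l - 1)"
      using comp_closed x y z one_m by auto
    have one_xz: "1 \<in> {1..m + l - 1}" using m by auto
    have x_yz: "op_comp P m (n + l - 1) 1 x (op_comp P n l 1 y z) = op_comp P (m + n - 1) l 1 (op_comp P m n 1 x y) z"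
      using comp_assoc_sequential[OF x y z one_m one_n] by simp
    have x_zy: "op_comp P m (n + l - 1) 1 x (op_comp P l n 1 z y) = op_comp P (m + l - 1) n 1 (op_comp P m l 1 x z) y"
      using comp_assoc_sequential[OF x z y one_m one_l] by (simp add: add.commute)
    have "op_comp P (m + n - 1) l (n + 1) (op_comp P m n 1 x y) z =
        op_comp P (m + l - 1) n 1 (op_comp P m l 2 x z) y"
      using comp_assoc_parallel[OF x y z one_m two_m] by (simp add: add.commute)
    also have "op_comp P m l 2 x z = op_scale P (\<kappa> ^ (l + 1)) (op_comp P m l 1 x z)"
      using comp_input[OF x z two_m l] by simp
    also have "op_comp P (m + l - 1) n 1 \<dots> y = op_scale P (\<kappa> ^ (l + 1)) (op_comp P (m + l - 1) n 1 (op_comp P m l 1 x z) y)"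
      by (rule comp_scale_left[OF xz y one_xz])
    also have "op_comp P (m + n - 1) l (n + 1) (op_comp P m n 1 x y) z =
        op_scale P (\<kappa> ^ ((l + 1) * n)) (op_comp P (m + n - 1) l 1 (op_comp P m n 1 x y) z)"
      using comp_input[OF xy z _ l, of "n + 1"] m by simp
    finally have eq: "op_scale P (\<kappa> ^ ((l + 1) * n)) (op_comp P (m + n - 1) l 1 (op_comp P m n 1 x y) z) =
        op_scale P (\<kappa> ^ (l + 1)) (op_comp P (m + l - 1) n 1 (op_comp P m l 1 x z) y)" .
    have "op_comp P (m + n - 1) l 1 (op_comp P m n 1 x y) z = op_scale P (\<kappa> ^ ((l + 1) * n))
        (op_scale P (\<kappa> ^ ((l + 1) * n)) (op_comp P (m + n - 1) l 1 (op_comp P m n 1 x y) z))"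
      by (simp only: scale_scale kappa_power_square scale_one)
    also have "\<dots> = op_scale P (\<kappa> ^ ((l + 1) * n) * \<kappa> ^ (l + 1))
        (op_comp P (m + l - 1) n 1 (op_comp P m l 1 x z) y)"
      unfolding eq by (rule scale_scale)
    also have "\<kappa> ^ ((l + 1) * n) * \<kappa> ^ (l + 1) = ?c"
    proof -
      have "(l + 1) * n + (l + 1) = (n + 1) * (l + 1)" by (simp add: algebra_simps)
      then show ?thesis by (simp only: power_add[symmetric])
    qed
    finally have "op_comp P (m + n - 1) l 1 (op_comp P m n 1 x y) z =
        op_scale P ?c (op_comp P (m + l - 1) n 1 (op_comp P m l 1 x z) y)" .
    then have "op_comp P m (n + l - 1) 1 x ?w = 0"
      using x_yz x_zy comp_diff_right[OF x yz space_scale[OF zy] one_m] comp_scale_right[OF x zy one_m] by simp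
    then show "op_comp P m (n + l - 1) i x ?w = 0" using comp_first_zero_imp_comp_zero[OF x w i] by blast
  qed
  then show ?thesis by simp
qed

text \<open>
  Supercommutativity makes the left annihilator of \<open>y\<close> an ideal.  If it contains \<open>x \<noteq> 0\<close>, then \<open>y\<close> is
  annihilated by a nonzero ideal.
\<close>

lemma comp_zero_imp_zero:
  assumes x: "x \<in> op_space P m" and y: "y \<in> op_space P n" and xy: "op_comp P m n 1 x y = 0"
  shows "x = 0 \<or> y = 0"
proof (rule ccontr)
  assume "\<not> ?thesis"
  then have x0: "x \<noteq> 0" and y0: "y \<noteq> 0" by auto
  have n: "n \<ge> 1" and one_n: "1 \<in> {1..n}" using arity_pos[OF y y0] by auto
  let ?J = "\<lambda>l. {u \<in> op_space P l. \<forall>i\<in>{1..l}. op_comp P l n i u y = 0}"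
  have "operad_ideal P ?J"
    unfolding operad_ideal_def
  proof (intro conjI allI impI)
    show "S_submodule P ?J"
      unfolding S_submodule_def
    proof (intro conjI allI impI)
      show "?J \<le> op_space P" by (auto simp: le_fun_def)
      show "subspace (?J l)" for l
        by (rule subspaceI) (auto simp: space_zero space_add space_scale comp_zero_left comp_add_left comp_scale_left y)
      show "op_act P l u \<sigma> \<in> ?J l" if u: "u \<in> ?J l" and \<sigma>: "\<sigma> permutes {1..l}" for l u \<sigma>
      proof -
        have "op_act P l u \<sigma> = op_scale P (if evenperm \<sigma> then 1 else \<kappa>) u" using act_by_sign u \<sigma> by blast
        moreover have "op_scale P (if evenperm \<sigma> then 1 else \<kappa>) u \<in> ?J l"
          by (rule subspace_scale[OF \<open>subspace (?J l)\<close> u])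
        ultimately show ?thesis by (simp only:)
      qed
    qed
    fix l k i u w
    assume u: "u \<in> op_space P l" and w: "w \<in> op_space P k" and i: "i \<in> {1..l}" and uw: "u \<in> ?J l \<or> w \<in> ?J k"
    have closed: "op_comp P l k i u w \<in> op_space P (l + k - 1)" using comp_closed[OF u w i] .
    have "op_comp P (l + k - 1) n 1 (op_comp P l k i u w) y = 0"
      if one_lk: "1 \<in> {1..l + k - 1}"
    proof (cases "w = 0")
      case True
      then show ?thesis using comp_zero_right[OF u i] comp_zero_left[OF y one_lk] by simp
    next
      case False
      then have k: "k \<ge> 1" and one_k: "1 \<in> {1..k}" using arity_pos w by auto
      have one_l: "1 \<in> {1..l}" using i by auto
      have "op_comp P (l + k - 1) n 1 (op_comp P l k 1 u w) y = op_comp P l (k + n - 1) 1 u (op_comp P k n 1 w y)"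
        using comp_assoc_sequential[OF u w y one_l one_k] by simp
      also have "\<dots> = 0"
        using uw
      proof
        assume "w \<in> ?J k"
        then have "op_comp P k n 1 w y = 0" using one_k by blast
        then show ?thesis using comp_zero_right[OF u one_l] by simp
      next
        assume "u \<in> ?J l"
        then have uy: "op_comp P l n 1 u y = 0" using one_l by blast
        have one_ln: "1 \<in> {1..l + n - 1}" using one_l one_n by auto
        have yw: "op_comp P n k 1 y w \<in> op_space P (k + n - 1)" using comp_closed[OF y w one_n] by (simp add: add.commute)
        have "op_comp P l (k + n - 1) 1 u (op_comp P k n 1 w y) =
          op_scale P (\<kappa> ^ ((k + 1) * (n + 1))) (op_comp P l (k + n - 1) 1 u (op_comp P n k 1 y w))"
          unfolding comp_supercommute[OF w y k n] by (rule comp_scale_right[OF u yw one_l])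
        also have "op_comp P l (k + n - 1) 1 u (op_comp P n k 1 y w) = op_comp P (l + n - 1) k 1 (op_comp P l n 1 u y) w"
          using comp_assoc_sequential[OF u y w one_l one_n] by (simp add: add.commute)
        also have "\<dots> = 0" using uy comp_zero_left[OF w one_ln] by simp
        finally show ?thesis by simp
      qed
      finally have first: "op_comp P (l + k - 1) n 1 (op_comp P l k 1 u w) y = 0" .
      show ?thesis
        unfolding comp_input[OF u w i k]
        using comp_scale_left[OF comp_closed[OF u w one_l] y one_lk] first by simp
    qed
    then show "op_comp P l k i u w \<in> ?J (l + k - 1)"
      using closed comp_first_zero_imp_comp_zero[OF closed y] by auto
  qed
  moreover have "x \<in> ?J m" using x comp_first_zero_imp_comp_zero[OF x y _ xy] by blast
  ultimately have "y = 0"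
    using prime_annihilated_imp_zero[OF prime _ _ x0 y, of ?J m] by blast
  then show False using y0 by contradiction
qed

text \<open>
  For \<open>\<kappa> = -1\<close>, supercommutativity gives \<open>y \<circ>\<^sub>1 y = - (y \<circ>\<^sub>1 y)\<close> for \<open>y\<close> of even arity.
\<close>

lemma kappa_trivial_or_even_arities_vanish:
  "\<kappa> = 1 \<or> (\<kappa> = -1 \<and> (\<forall>n y. even n \<longrightarrow> y \<in> op_space P n \<longrightarrow> y = 0))"
proof (cases "\<kappa> = 1")
  case False
  then have \<kappa>: "\<kappa> = -1" using kappa by blast
  then have two: "(1 + 1 :: 'k) \<noteq> 0" using False eq_neg_iff_add_eq_0[of "1::'k" 1] by auto
  have "y = 0" if n: "even n" and y: "y \<in> op_space P n" for n y
  proof (rule ccontr)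
    assume y0: "y \<noteq> 0"
    then have "n \<ge> 1" using arity_pos y by blast
    moreover have "odd ((n + 1) * (n + 1))" using n by simp
    ultimately have "op_comp P n n 1 y y = op_scale P (- 1) (op_comp P n n 1 y y)"
      using comp_supercommute[OF y y] \<kappa> by (metis power_minus_odd power_one)
    then have "op_scale P (1 + 1) (op_comp P n n 1 y y) = 0" by (simp only: scale_left_distrib) (simp add: eq_neg_iff_add_eq_0)
    then have "op_comp P n n 1 y y = 0" using two scale_eq_0_iff by blast
    then show False using comp_zero_imp_zero[OF y y] y0 by blast
  qed
  then show ?thesis using \<kappa> by blast
qed simp

lemma kappa_power_scale:
  assumes "x \<in> op_space P m" "y \<in> op_space P n" "i \<in> {1..m}"
  shows "op_scale P (\<kappa> ^ ((n + 1) * j)) (op_comp P m n i x y) = op_comp P m n i x y"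
proof (cases "\<kappa> = 1 \<or> odd n")
  case True
  then show ?thesis using kappa by (auto simp: power_mult)
next
  case False
  then have "y = 0" using kappa_trivial_or_even_arities_vanish assms by blast
  then show ?thesis using comp_zero_right assms by simp
qed

lemma comp_input_irrelevant:
  assumes "x \<in> op_space P m" "y \<in> op_space P n" "i \<in> {1..m}"
  shows "op_comp P m n i x y = op_comp P m n 1 x y"
proof (cases "n = 0")
  case True
  then have "y = 0" using arity_pos assms by fastforce
  then show ?thesis using comp_zero_right[OF assms(1)] assms(3) by auto
next
  case False
  moreover have "1 \<in> {1..m}" using assms(3) by auto
  ultimately show ?thesis using comp_input[OF assms] kappa_power_scale[OF assms(1,2)] by simp
qed

lemma comp_commute:
  assumes "y \<in> op_space P n" "z \<in> op_space P l" "n \<ge> 1" "l \<ge> 1"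
  shows "op_comp P n l 1 y z = op_comp P l n 1 z y"
  using comp_supercommute[OF assms] kappa_power_scale[OF assms(2,1), of 1 "l + 1"] assms(4) by simp

lemma unit_nonzero: "op_unit P \<noteq> 0"
proof
  assume zero: "op_unit P = 0"
  obtain n x where "x \<in> op_space P n" "x \<noteq> 0" using unbounded by blast
  then show False using unit_comp[of x n] comp_zero_left[of x n 1 1] zero by simp
qed

text \<open>
  An operation of arity \<open>p + 1\<close> has degree \<open>p\<close>, which makes degrees additive under composition.
\<close>

lemma graded_commutative_domain:
  "graded_commutative_domain (op_scale P) (\<lambda>p. op_space P (Suc p)) (\<lambda>p q. op_comp P (Suc p) (Suc q) 1) (op_unit P)"
proof
  fix p q r x x' y z and c :: 'k
  show "subspace (op_space P (Suc p))" by (rule space_subspace)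
  show "op_comp P (Suc p) (Suc q) 1 x y \<in> op_space P (Suc (p + q))"
    if "x \<in> op_space P (Suc p)" "y \<in> op_space P (Suc q)"
    using comp_closed[OF that, of 1] by simp
  show "op_comp P (Suc p) (Suc q) 1 (x + x') y = op_comp P (Suc p) (Suc q) 1 x y + op_comp P (Suc p) (Suc q) 1 x' y"
    if "x \<in> op_space P (Suc p)" "x' \<in> op_space P (Suc p)" "y \<in> op_space P (Suc q)"
    using comp_add_left[OF that, of 1] by simp
  show "op_comp P (Suc p) (Suc q) 1 (op_scale P c x) y = op_scale P c (op_comp P (Suc p) (Suc q) 1 x y)"
    if "x \<in> op_space P (Suc p)" "y \<in> op_space P (Suc q)"
    using comp_scale_left[OF that, of 1] by simp
  show "op_comp P (Suc p) (Suc q) 1 x y = op_comp P (Suc q) (Suc p) 1 y x"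
    if "x \<in> op_space P (Suc p)" "y \<in> op_space P (Suc q)"
    using comp_commute[OF that] by simp
  show "op_comp P (Suc (p + q)) (Suc r) 1 (op_comp P (Suc p) (Suc q) 1 x y) z =
      op_comp P (Suc p) (Suc (q + r)) 1 x (op_comp P (Suc q) (Suc r) 1 y z)"
    if "x \<in> op_space P (Suc p)" "y \<in> op_space P (Suc q)" "z \<in> op_space P (Suc r)"
    using comp_assoc_sequential[OF that, of 1 1] by simp
  show "op_unit P \<in> op_space P (Suc 0)" using unit_closed by simp
  show "op_comp P (Suc 0) (Suc p) 1 (op_unit P) x = x" if "x \<in> op_space P (Suc p)"
    using unit_comp[OF that] by simp
  show "op_unit P \<noteq> 0" by (rule unit_nonzero)
  show "x = 0 \<or> y = 0" if "x \<in> op_space P (Suc p)" "y \<in> op_space P (Suc q)" "op_comp P (Suc p) (Suc q) 1 x y = 0"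
    using comp_zero_imp_zero[OF that(1,2)] that(3) by simp
qed

end

section \<open>Embedding into a one-dimensional operad\<close>

text \<open>
  The common part of the two cases of the classification: in \<open>Com\<close> and \<open>Ope\<close> composition is
  multiplication of scalars.
\<close>

lemma (in reduced_operad) is_suboperad_of_scalar_operad:
  fixes Q :: "('k, 'k) operad_data" and f :: "nat \<Rightarrow> 'v \<Rightarrow> 'k"
  assumes Q: "op_scale Q = (*)" "op_unit Q = 1" "\<And>m n i x y. op_comp Q m n i x y = x * y"
    and closed: "\<And>n x. x \<in> op_space P n \<Longrightarrow> f n x \<in> op_space Q n"
    and add: "\<And>n x y. x \<in> op_space P n \<Longrightarrow> y \<in> op_space P n \<Longrightarrow> f n (x + y) = f n x + f n y"
    and scale: "\<And>n c x. x \<in> op_space P n \<Longrightarrow> f n (op_scale P c x) = c * f n x"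
    and act: "\<And>n x \<sigma>. x \<in> op_space P n \<Longrightarrow> \<sigma> permutes {1..n} \<Longrightarrow> f n (op_act P n x \<sigma>) = op_act Q n (f n x) \<sigma>"
    and comp: "\<And>m n i x y. x \<in> op_space P m \<Longrightarrow> y \<in> op_space P n \<Longrightarrow> i \<in> {1..m} \<Longrightarrow>
      f (m + n - 1) (op_comp P m n i x y) = f m x * f n y"
    and unit: "f 1 (op_unit P) = 1"
    and nonzero: "\<And>n x. x \<in> op_space P n \<Longrightarrow> f n x = 0 \<Longrightarrow> x = 0"
  shows "is_suboperad_of P Q"
proof -
  define S where "S n = f n ` op_space P n" for n
  interpret scalars: vector_space "(*) :: 'k \<Rightarrow> 'k \<Rightarrow> 'k"
    by unfold_locales (simp_all add: algebra_simps)
  have fS: "f n x \<in> S n" if "x \<in> op_space P n" for n x using that by (simp add: S_def)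
  have "suboperad Q S"
    unfolding suboperad_def S_submodule_def
  proof (intro conjI allI impI)
    show "S \<le> op_space Q" using closed by (auto simp: S_def le_fun_def)
    show "module.subspace (op_scale Q) (S n)" for n
      unfolding Q
    proof (rule scalars.subspaceI)
      show "0 \<in> S n" using scale[OF space_zero, of n 0] fS[OF space_zero[of n]] by simp
      show "x + y \<in> S n" if xy: "x \<in> S n" "y \<in> S n" for x y
      proof -
        obtain u w where "u \<in> op_space P n" "w \<in> op_space P n" "x = f n u" "y = f n w" using xy by (auto simp: S_def)
        then show ?thesis using fS[OF space_add] add by metis
      qed
      show "c * x \<in> S n" if x: "x \<in> S n" for c x
      proof -
        obtain u where "u \<in> op_space P n" "x = f n u" using x by (auto simp: S_def)
        then show ?thesis using fS[OF space_scale] scale by metis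
      qed
    qed
    show "op_act Q n x \<sigma> \<in> S n" if x: "x \<in> S n" and \<sigma>: "\<sigma> permutes {1..n}" for n x \<sigma>
    proof -
      obtain u where "u \<in> op_space P n" "x = f n u" using x by (auto simp: S_def)
      then show ?thesis using fS[OF act_closed] act \<sigma> by metis
    qed
    show "op_unit Q \<in> S 1" using fS[OF unit_closed] unit Q by simp
    show "op_comp Q m n i x y \<in> S (m + n - 1)" if xy: "x \<in> S m" "y \<in> S n" "i \<in> {1..m}" for m n i x y
    proof -
      obtain u w where "u \<in> op_space P m" "w \<in> op_space P n" "x = f m u" "y = f n w" using xy by (auto simp: S_def)
      then show ?thesis using fS[OF comp_closed] comp xy(3) Q(3) by metis
    qed
  qed
  moreover have "operad_isomorphic P (Q\<lparr>op_space := S\<rparr>)"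
    unfolding operad_isomorphic_def
  proof (intro exI[of _ f] conjI allI)
    show "operad_hom P (Q\<lparr>op_space := S\<rparr>) f"
      unfolding operad_hom_def using fS add scale act comp unit Q by auto
    show "bij_betw (f n) (op_space P n) (op_space (Q\<lparr>op_space := S\<rparr>) n)" for n
    proof -
      have "inj_on (f n) (op_space P n)"
      proof (rule inj_onI)
        fix x y assume xy: "x \<in> op_space P n" "y \<in> op_space P n" "f n x = f n y"
        have diff: "x - y \<in> op_space P n" using space_diff xy by blast
        have "f n (x - y) = 0" using add[OF xy(2) diff] xy(3) by simp
        then have "x - y = 0" using nonzero diff by blast
        then show "x = y" by simp
      qed
      then show ?thesis by (simp add: bij_betw_def S_def)
    qed
  qed
  ultimately show ?thesis unfolding is_suboperad_of_def by blast
qed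

lemma (in operad) nonzero_of_dim_nonzero:
  assumes "dim (op_space P n) \<noteq> 0"
  shows "\<exists>x\<in>op_space P n. x \<noteq> 0"
proof (rule ccontr)
  assume "\<not> ?thesis"
  then have "op_space P n \<subseteq> span {}" by auto
  then show False using dim_le_card[of "op_space P n" "{}"] assms by simp
qed

locale sign_operad_alg_closed = sign_operad P \<kappa>
  for P :: "('k::alg_closed_field, 'v::ab_group_add) operad_data" and \<kappa>
begin

sublocale graded: graded_commutative_domain_alg_closed "op_scale P" "\<lambda>p. op_space P (Suc p)"
  "\<lambda>p q. op_comp P (Suc p) (Suc q) 1" "op_unit P"
  using graded_commutative_domain by (simp add: graded_commutative_domain_alg_closed_def)

text \<open>
  Independent \<open>x\<close> and \<open>y\<close> of degree \<open>p\<close> give dimension at least \<open>k + 1\<close> in degree \<open>k p\<close> for all \<open>k\<close>.  For \<open>p = 0\<close>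
  this contradicts local finiteness in arity 1, and for \<open>p > 0\<close> the growth assumption, because the arities
  \<open>k p + 1\<close> have gaps of length \<open>p\<close>.
\<close>

lemma components_proportional:
  assumes lf: "locally_finite P" and gk: "GKdim P = 1"
    and x: "x \<in> op_space P (Suc p)" and y: "y \<in> op_space P (Suc p)" "y \<noteq> 0"
  shows "\<exists>c. x = op_scale P c y"
proof (rule ccontr)
  assume none: "\<not> ?thesis"
  have large: "k < dim (op_space P (Suc (k * p)))" for k
  proof (rule ccontr)
    assume "\<not> ?thesis"
    moreover obtain B where "finite B" "span B = op_space P (Suc (k * p))" "card B = dim (op_space P (Suc (k * p)))"
      using finite_basis[OF lf] by metis
    ultimately show False using graded.small_dimension_imp_proportional[OF x y, of B k] none by simp
  qed
  show False
  proof (cases "p = 0")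
    case True
    then show False using large[of "dim (op_space P 1)"] by simp
  next
    case False
    have "\<exists>n\<in>{a..<a+p}. n \<le> p * (dim (op_space P n))\<^sup>2" if a: "a \<ge> 1" for a
    proof -
      \<comment> \<open>The quotient of \<open>a - 1\<close> by \<open>p\<close>, rounded up.\<close>
      define k where "k = (a - 1 + (p - 1)) div p"
      define r where "r = (a - 1 + (p - 1)) mod p"
      have "k * p + r = a - 1 + (p - 1)" "r < p" using False by (auto simp: k_def r_def)
      then have "Suc (k * p) \<in> {a..<a+p}" using a False by auto
      moreover have "Suc (k * p) \<le> p * (dim (op_space P (Suc (k * p))))\<^sup>2"
      proof -
        have "Suc (k * p) \<le> p * Suc k" using False by simp
        also have "\<dots> \<le> p * dim (op_space P (Suc (k * p)))" using large[of k] by (intro mult_le_mono2) simp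
        also have "\<dots> \<le> p * (dim (op_space P (Suc (k * p))))\<^sup>2"
          by (intro mult_le_mono2) (simp add: power2_eq_square)
        finally show ?thesis .
      qed
      ultimately show ?thesis by blast
    qed
    moreover obtain a where "a \<ge> 1" "\<forall>n\<in>{a..<a+p}. n > p * (dim (op_space P n))\<^sup>2"
      using growth_one_imp_small_window[OF gk[unfolded GKdim_def], of p p] False by auto
    ultimately show False by (meson leD)
  qed
qed

text \<open>
  The embedding of the graded algebra is compatible with composition at every input, because composition
  does not depend on the input.
\<close>

lemma is_suboperad_of_Com_or_Ope:
  assumes lf: "locally_finite P" and gk: "GKdim P = 1"
  shows "is_suboperad_of P (Com :: ('k, 'k) operad_data) \<or> is_suboperad_of P (Ope :: ('k, 'k) operad_data)"
proof -
  obtain f :: "nat \<Rightarrow> 'v \<Rightarrow> 'k" where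
    f_add: "\<And>p x y. x \<in> op_space P (Suc p) \<Longrightarrow> y \<in> op_space P (Suc p) \<Longrightarrow> f p (x + y) = f p x + f p y" and
    f_scale: "\<And>p c x. x \<in> op_space P (Suc p) \<Longrightarrow> f p (op_scale P c x) = c * f p x" and
    f_mul: "\<And>p q x y. x \<in> op_space P (Suc p) \<Longrightarrow> y \<in> op_space P (Suc q) \<Longrightarrow>
      f (p + q) (op_comp P (Suc p) (Suc q) 1 x y) = f p x * f q y" and
    f_unit: "f 0 (op_unit P) = 1" and
    f_zero: "\<And>p x. x \<in> op_space P (Suc p) \<Longrightarrow> f p x = 0 \<longleftrightarrow> x = 0"
  proof (rule graded.embedding_of_one_dimensional)
    show "\<exists>c. x = op_scale P c y" if "x \<in> op_space P (Suc p)" "y \<in> op_space P (Suc p)" "y \<noteq> 0" for p x y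
      by (rule components_proportional[OF lf gk that])
  qed (rule that; assumption)
  define F where "F n x = (if n = 0 then 0 else f (n - 1) x)" for n x
  have P0: "x = 0" if "x \<in> op_space P 0" for x using arity_pos[OF that] by auto
  have F_add: "F n (x + y) = F n x + F n y" if "x \<in> op_space P n" "y \<in> op_space P n" for n x y
    using f_add that by (cases n) (auto simp: F_def)
  have F_scale: "F n (op_scale P c x) = c * F n x" if "x \<in> op_space P n" for n c x
    using f_scale that by (cases n) (auto simp: F_def)
  have F_zero: "F n x = 0 \<longleftrightarrow> x = 0" if "x \<in> op_space P n" for n x
    using f_zero that P0 by (cases n) (auto simp: F_def)
  have F_comp: "F (m + n - 1) (op_comp P m n i x y) = F m x * F n y"
    if x: "x \<in> op_space P m" and y: "y \<in> op_space P n" and i: "i \<in> {1..m}" for m n i x y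
  proof (cases "n = 0")
    case True
    then have "y = 0" using P0 y by simp
    then have "op_comp P m n i x y = 0" "F n y = 0" using comp_zero_right[OF x i] F_zero[OF y] by auto
    then show ?thesis using F_zero[OF comp_closed[OF x y i]] by simp
  next
    case False
    then obtain p q where pq: "m = Suc p" "n = Suc q" using i by (metis atLeastAtMost_iff not0_implies_Suc not_one_le_zero order_trans)
    have "F (m + n - 1) (op_comp P m n i x y) = f (p + q) (op_comp P (Suc p) (Suc q) 1 x y)"
      using comp_input_irrelevant[OF x y i] by (simp add: F_def pq)
    then show ?thesis using f_mul x y by (simp add: F_def pq)
  qed
  have F_unit: "F 1 (op_unit P) = 1" using f_unit by (simp add: F_def)
  from kappa_trivial_or_even_arities_vanish show ?thesis
  proof
    assume \<kappa>: "\<kappa> = 1"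
    have "is_suboperad_of P (Com :: ('k, 'k) operad_data)"
    proof (rule is_suboperad_of_scalar_operad[where f = F])
      show "F n x \<in> op_space Com n" if "x \<in> op_space P n" for n x
        by (simp add: Com_def F_def)
      show "F n (op_act P n x \<sigma>) = op_act Com n (F n x) \<sigma>" if "x \<in> op_space P n" "\<sigma> permutes {1..n}" for n x \<sigma>
        using act_by_sign[OF that] \<kappa> by (simp add: Com_def)
    qed (use F_add F_scale F_comp F_unit F_zero in \<open>auto simp: Com_def simp del: One_nat_def\<close>)
    then show ?thesis ..
  next
    assume \<kappa>: "\<kappa> = -1 \<and> (\<forall>n y. even n \<longrightarrow> y \<in> op_space P n \<longrightarrow> y = 0)"
    have "is_suboperad_of P (Ope :: ('k, 'k) operad_data)"
    proof (rule is_suboperad_of_scalar_operad[where f = F])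
      show "F n x \<in> op_space Ope n" if "x \<in> op_space P n" for n x
        using \<kappa> that F_zero[OF that] by (auto simp: Ope_def)
      show "F n (op_act P n x \<sigma>) = op_act Ope n (F n x) \<sigma>" if "x \<in> op_space P n" "\<sigma> permutes {1..n}" for n x \<sigma>
        using act_by_sign[OF that] \<kappa> F_scale[OF that(1)] by (simp add: Ope_def sign_def)
    qed (use F_add F_scale F_comp F_unit F_zero in \<open>auto simp: Ope_def simp del: One_nat_def\<close>)
    then show ?thesis ..
  qed
qed

end

section \<open>The classification\<close>

theorem theorem0p3:
  fixes P :: "('k::alg_closed_field, 'v::ab_group_add) operad_data"
  assumes "operad P"
    and "reduced P"
    and "locally_finite P"
    and "finitely_generated P"
    and "prime_operad P"
    and "GKdim P = 1"
  shows "is_suboperad_of P (Com :: ('k, 'k) operad_data) \<or>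
         is_suboperad_of P (Ope :: ('k, 'k) operad_data)"
proof -
  interpret operad P by fact
  have "\<exists>n\<ge>a. \<exists>x\<in>op_space P n. x \<noteq> 0" for a
    using growth_one_imp_unbounded_support[OF assms(6)[unfolded GKdim_def]] nonzero_of_dim_nonzero by meson
  then interpret unbounded_prime_operad P
    using assms(2,5) by unfold_locales
  interpret alternating_trivial_operad P
    by unfold_locales (rule transpositions_act_equally[OF assms(3,4,6)])
  obtain \<kappa> where \<kappa>: "\<kappa> = 1 \<or> \<kappa> = -1" "\<And>n x. n \<ge> 2 \<Longrightarrow> x \<in> op_space P n \<Longrightarrow> swap n x = op_scale P \<kappa> x"
    using swap_is_scalar by blast
  interpret sign_operad_alg_closed P \<kappa>
  proof
    show "\<kappa> = 1 \<or> \<kappa> = -1" by fact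
    show "op_act P n x (transpose a b) = op_scale P \<kappa> x"
      if "x \<in> op_space P n" "a \<in> {1..n}" "b \<in> {1..n}" "a \<noteq> b" for n x a b
      using act_transpose[OF that] \<kappa>(2)[OF _ that(1)] that by (auto simp: swap_def)
  qed
  show ?thesis using is_suboperad_of_Com_or_Ope assms(3,6) by blast
qed

end
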